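(* Every atomic space in $L^2([0,1])$ is equal to $\mathcal{A}_{\tau,w}$ for exactly one pair $(\tau,w)\in\mathbb{T}\times(0,\infty)$.
   Context: $\mathbb{S}=\{s\in\mathbb{C}:\operatorname{Re}s>-\tfrac12\}$, $\mathbb{T}$ is the unit circle. For $\rho\in[0,1]$, $L^2([\rho,1])$ is identified with the subspace of $L^2([0,1])$ of functions vanishing a.e. on $[0,\rho]$. A bounded operator $T$ on $L^2([0,1])$ is a monomial operator if for every $s\in\mathbb{S}$ there exist $\tau\in\mathbb{S}$, $c\in\mathbb{C}$ with $Tx^s=cx^\tau$. A subspace $\mathcal{M}$ is atomic if $\mathcal{M}=TL^2([\rho,1])$ for some $\rho\in(0,1)$ and some unitary monomial operator $T$. Let $e_n(x)=\sum_{k=0}^n\binom{n}{k}\frac{(\ln x)^k}{k!}$ ($n\ge0$), an orthonormal basis of $L^2([0,1])$, and let $J$ be the unitary with $Je_n=(-1)^ne_n$. For real $c$, $M_{x^{ic}}$ denotes multiplication by $x^{ic}$. For $w>0$ define $\mathcal{A}_{1,w}=L^2([e^{-2w},1])$, $\mathcal{A}_{-1,w}=J\mathcal{A}_{1,w}$, and for $\tau\in\mathbb{T}\setminus\{1\}$, $\mathcal{A}_{\tau,w}=M_{x^{ic}}\mathcal{A}_{-1,\wp}$ where $c\in\mathbb{R}$ is given by $2ic=\frac{\tau+1}{\tau-1}$ and $\wp=(1+4c^2)w$. *)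

theory Defs
  imports "HOL-Analysis.Analysis"
begin

text \<open>Elements of L^2([0,1]) are represented by complex-valued functions on the reals,
  considered modulo equality almost everywhere on [0,1] (Lebesgue measure).
  Subspaces are represented as sets of representatives that are saturated under
  a.e. equality.\<close>

abbreviation M01 :: "real measure" where
  "M01 \<equiv> lebesgue_on {0..1}"

definition L2 :: "(real \<Rightarrow> complex) set" where
  "L2 = {f. f \<in> borel_measurable M01 \<and> integrable M01 (\<lambda>x. (cmod (f x))\<^sup>2)}"

definition ae_eq :: "(real \<Rightarrow> complex) \<Rightarrow> (real \<Rightarrow> complex) \<Rightarrow> bool" where
  "ae_eq f g \<longleftrightarrow> (AE x in M01. f x = g x)"

definition l2_inner :: "(real \<Rightarrow> complex) \<Rightarrow> (real \<Rightarrow> complex) \<Rightarrow> complex" where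
  "l2_inner f g = (LINT x|M01. f x * cnj (g x))"

definition l2_norm :: "(real \<Rightarrow> complex) \<Rightarrow> real" where
  "l2_norm f = sqrt (LINT x|M01. (cmod (f x))\<^sup>2)"

definition bounded_op :: "((real \<Rightarrow> complex) \<Rightarrow> (real \<Rightarrow> complex)) \<Rightarrow> bool" where
  "bounded_op T \<longleftrightarrow>
     (\<forall>f\<in>L2. T f \<in> L2) \<and>
     (\<forall>f\<in>L2. \<forall>g\<in>L2. ae_eq f g \<longrightarrow> ae_eq (T f) (T g)) \<and>
     (\<forall>f\<in>L2. \<forall>g\<in>L2. \<forall>a b. ae_eq (T (\<lambda>x. a * f x + b * g x)) (\<lambda>x. a * T f x + b * T g x)) \<and>
     (\<exists>K. \<forall>f\<in>L2. l2_norm (T f) \<le> K * l2_norm f)"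

definition unitary_op :: "((real \<Rightarrow> complex) \<Rightarrow> (real \<Rightarrow> complex)) \<Rightarrow> bool" where
  "unitary_op T \<longleftrightarrow> bounded_op T \<and>
     (\<forall>f\<in>L2. \<forall>g\<in>L2. l2_inner (T f) (T g) = l2_inner f g) \<and>
     (\<forall>g\<in>L2. \<exists>f\<in>L2. ae_eq (T f) g)"

definition Shalf :: "complex set" where
  "Shalf = {s. Re s > -1/2}"

definition mon :: "complex \<Rightarrow> real \<Rightarrow> complex" where
  "mon s = (\<lambda>x. complex_of_real x powr s)"

definition monomial_op :: "((real \<Rightarrow> complex) \<Rightarrow> (real \<Rightarrow> complex)) \<Rightarrow> bool" where
  "monomial_op T \<longleftrightarrow> bounded_op T \<and>
     (\<forall>s\<in>Shalf. \<exists>\<tau>\<in>Shalf. \<exists>c::complex. ae_eq (T (mon s)) (\<lambda>x. c * mon \<tau> x))"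

definition L2_on :: "real \<Rightarrow> (real \<Rightarrow> complex) set" where
  "L2_on \<rho> = {f \<in> L2. AE x in M01. x \<le> \<rho> \<longrightarrow> f x = 0}"

definition op_image :: "((real \<Rightarrow> complex) \<Rightarrow> (real \<Rightarrow> complex)) \<Rightarrow> (real \<Rightarrow> complex) set
    \<Rightarrow> (real \<Rightarrow> complex) set" where
  "op_image T A = {g \<in> L2. \<exists>f\<in>A. ae_eq (T f) g}"

definition atomic :: "(real \<Rightarrow> complex) set \<Rightarrow> bool" where
  "atomic M \<longleftrightarrow> (\<exists>\<rho>. 0 < \<rho> \<and> \<rho> < 1 \<and> (\<exists>T. unitary_op T \<and> monomial_op T \<and> M = op_image T (L2_on \<rho>)))"

definition e_basis :: "nat \<Rightarrow> real \<Rightarrow> complex" where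
  "e_basis n = (\<lambda>x. \<Sum>k\<le>n. of_nat (n choose k) * (complex_of_real (ln x))^k / of_nat (fact k))"

text \<open>J is the unitary with J e_n = (-1)^n e_n; since (e_n) is an orthonormal basis, J f is
  characterised by its coefficients: <J f, e_n> = (-1)^n <f, e_n>.
  Hence J A = {g in L2. exists f in A. for all n, <g,e_n> = (-1)^n <f,e_n>}.\<close>
definition J_image :: "(real \<Rightarrow> complex) set \<Rightarrow> (real \<Rightarrow> complex) set" where
  "J_image A = {g \<in> L2. \<exists>f\<in>A. \<forall>n. l2_inner g (e_basis n) = (-1)^n * l2_inner f (e_basis n)}"

definition A_one :: "real \<Rightarrow> (real \<Rightarrow> complex) set" where
  "A_one w = L2_on (exp (-2 * w))"

definition A_minus_one :: "real \<Rightarrow> (real \<Rightarrow> complex) set" where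
  "A_minus_one w = J_image (A_one w)"

text \<open>For tau on the unit circle, tau \<noteq> 1, the real number c with 2 i c = (tau+1)/(tau-1).\<close>
definition c_of :: "complex \<Rightarrow> real" where
  "c_of \<tau> = Re ((\<tau> + 1) / (2 * \<i> * (\<tau> - 1)))"

definition mult_image :: "real \<Rightarrow> (real \<Rightarrow> complex) set \<Rightarrow> (real \<Rightarrow> complex) set" where
  "mult_image c A = {g \<in> L2. \<exists>f\<in>A. ae_eq g (\<lambda>x. mon (\<i> * of_real c) x * f x)}"

definition A_space :: "complex \<Rightarrow> real \<Rightarrow> (real \<Rightarrow> complex) set" where
  "A_space \<tau> w =
     (if \<tau> = 1 then A_one w
      else mult_image (c_of \<tau>) (A_minus_one ((1 + 4 * (c_of \<tau>)\<^sup>2) * w)))"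

end

theory Submission
  imports Defs "HOL-Complex_Analysis.Cauchy_Integral_Formula"
begin

text \<open>
  The Mellin transform \<open>u \<mapsto> \<langle>f, x\<^bsup>u - 1/2\<^esup>\<rangle>\<close> on the right half-plane determines \<open>f\<close>, because
  polynomials are dense. A unitary monomial operator preserves the kernel
  \<open>\<langle>x\<^bsup>u - 1/2\<^esup>, x\<^bsup>v - 1/2\<^esup>\<rangle> = 1 / (u + cnj v)\<close>, so it acts on transforms by composition with an
  automorphism of the half-plane, which is either \<open>u \<mapsto> a u + ib\<close> or \<open>u \<mapsto> ib + a / (u - ic)\<close>.
  The first is a dilation and maps \<open>L\<^sup>2([\<rho>,1])\<close> to \<open>L\<^sup>2([\<rho>\<^bsup>1/a\<^esup>,1])\<close>. The operator \<open>J\<close> corresponds to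
  \<open>u \<mapsto> 1 / (4u)\<close>, since the transform of \<open>e\<^sub>n\<close> is \<open>(u - 1/2)\<^sup>n / (u + 1/2)\<^bsup>n+1\<^esup>\<close> up to conjugation; hence the
  second map is a dilation followed by \<open>J\<close> and the multiplication by \<open>x\<^bsup>ib\<^esup>\<close>.

  For uniqueness, transforms of elements of \<open>L\<^sup>2([\<rho>,1])\<close> extend continuously to the whole plane,
  whereas in the space obtained from \<open>J\<close> and \<open>x\<^bsup>ib\<^esup>\<close> the image of an indicator function oscillates
  at \<open>ib\<close>, and there only. So \<open>b\<close> can be read off, and then \<open>\<rho>\<close>.
\<close>

section \<open>Integration over the unit interval\<close>

lemma integrable_M01_iff: "integrable M01 f \<longleftrightarrow> f absolutely_integrable_on {0..1}"
  for f :: "real \<Rightarrow> 'a::euclidean_space"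
  unfolding set_integrable_def by (rule integrable_restrict_space) auto

lemma lint_M01: "integrable M01 f \<Longrightarrow> (LINT x|M01. f x) = integral {0..1} f"
  for f :: "real \<Rightarrow> 'a::euclidean_space"
  using has_integral_integral_lebesgue_on[of "{0..1}" f] by (simp add: integral_unique)

lemma AE_M01_pos: "AE x in M01. 0 < x \<and> x < 1"
proof -
  have "{0::real,1} \<in> null_sets lebesgue" by simp
  then have "AE x in lebesgue. x \<notin> {0::real,1}" by (rule AE_not_in)
  then have "AE x in lebesgue. x \<in> {0..1} \<longrightarrow> 0 < x \<and> x < (1::real)"
    by eventually_elim auto
  then show ?thesis by (subst AE_restrict_space_iff) auto
qed

lemma measurable_M01_borel:
  "f \<in> borel_measurable borel \<Longrightarrow> f \<in> borel_measurable M01"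
  by (intro measurable_restrict_space1 measurable_completion) auto

subsection \<open>The space of square-integrable functions\<close>

lemma L2_measurable: "f \<in> L2 \<Longrightarrow> f \<in> borel_measurable M01"
  by (simp add: L2_def)

lemma L2_integrable_sq: "f \<in> L2 \<Longrightarrow> integrable M01 (\<lambda>x. (cmod (f x))\<^sup>2)"
  by (simp add: L2_def)

lemma borel_measurable_cnj [measurable]: "cnj \<in> borel_measurable borel"
  by (intro borel_measurable_continuous_onI continuous_on_cnj continuous_on_id)

lemma L2_mult_integrable:
  assumes "f \<in> L2" "g \<in> L2"
  shows "integrable M01 (\<lambda>x. f x * cnj (g x))"
proof (rule Bochner_Integration.integrable_bound)
  show "integrable M01 (\<lambda>x. (cmod (f x))\<^sup>2 + (cmod (g x))\<^sup>2)"
    using assms by (intro Bochner_Integration.integrable_add L2_integrable_sq)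
  show "(\<lambda>x. f x * cnj (g x)) \<in> borel_measurable M01"
    using assms[THEN L2_measurable] by measurable
  have "a * b \<le> a\<^sup>2 + b\<^sup>2" if "a \<ge> 0" "b \<ge> 0" for a b :: real
    using sum_squares_bound[of a b] mult_nonneg_nonneg[OF that] by linarith
  then show "AE x in M01. norm (f x * cnj (g x)) \<le> norm ((cmod (f x))\<^sup>2 + (cmod (g x))\<^sup>2)"
    by (auto simp: norm_mult)
qed

lemma L2_const: "(\<lambda>x. c) \<in> L2"
proof -
  interpret finite_measure M01 by (intro finite_measure_lebesgue_on) auto
  show ?thesis by (simp add: L2_def)
qed

lemma L2_integrable: "f \<in> L2 \<Longrightarrow> integrable M01 f"
  using L2_mult_integrable[OF _ L2_const[of 1]] by simp

lemma L2_bound: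
  assumes "g \<in> borel_measurable M01" "integrable M01 h"
    "AE x in M01. (cmod (g x))\<^sup>2 \<le> h x"
  shows "g \<in> L2"
proof -
  have "integrable M01 (\<lambda>x. (cmod (g x))\<^sup>2)"
  proof (rule Bochner_Integration.integrable_bound[OF assms(2)])
    show "(\<lambda>x. (cmod (g x))\<^sup>2) \<in> borel_measurable M01" using assms(1) by measurable
    show "AE x in M01. norm ((cmod (g x))\<^sup>2) \<le> norm (h x)"
      using assms(3) by eventually_elim auto
  qed
  with assms(1) show ?thesis by (simp add: L2_def)
qed

lemma L2_add:
  assumes "f \<in> L2" "g \<in> L2" shows "(\<lambda>x. f x + g x) \<in> L2"
proof (rule L2_bound)
  show "(\<lambda>x. f x + g x) \<in> borel_measurable M01"
    using assms[THEN L2_measurable] by measurable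
  show "integrable M01 (\<lambda>x. 2 * (cmod (f x))\<^sup>2 + 2 * (cmod (g x))\<^sup>2)"
    using assms[THEN L2_integrable_sq] by auto
  have "(cmod (a + b))\<^sup>2 \<le> 2 * (cmod a)\<^sup>2 + 2 * (cmod b)\<^sup>2" for a b
  proof -
    have "(cmod (a + b))\<^sup>2 \<le> (cmod a + cmod b)\<^sup>2"
      by (intro power_mono norm_triangle_ineq) auto
    also have "\<dots> \<le> 2 * (cmod a)\<^sup>2 + 2 * (cmod b)\<^sup>2"
      using sum_squares_bound[of "cmod a" "cmod b"] by (simp add: power2_sum)
    finally show ?thesis .
  qed
  then show "AE x in M01. (cmod (f x + g x))\<^sup>2 \<le> 2 * (cmod (f x))\<^sup>2 + 2 * (cmod (g x))\<^sup>2"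
    by simp
qed

lemma L2_scale: "f \<in> L2 \<Longrightarrow> (\<lambda>x. c * f x) \<in> L2"
  by (auto simp: L2_def norm_mult power_mult_distrib)

lemma L2_diff: "f \<in> L2 \<Longrightarrow> g \<in> L2 \<Longrightarrow> (\<lambda>x. f x - g x) \<in> L2"
  using L2_add[OF _ L2_scale[of g "-1"]] by simp

lemma L2_sum: "finite I \<Longrightarrow> (\<And>i. i \<in> I \<Longrightarrow> f i \<in> L2) \<Longrightarrow> (\<lambda>x. \<Sum>i\<in>I. f i x) \<in> L2"
  by (induction rule: finite_induct) (auto intro: L2_add L2_const)

lemma inner_add_left:
  "f \<in> L2 \<Longrightarrow> g \<in> L2 \<Longrightarrow> h \<in> L2 \<Longrightarrow>
    l2_inner (\<lambda>x. f x + g x) h = l2_inner f h + l2_inner g h"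
  unfolding l2_inner_def
  by (subst Bochner_Integration.integral_add[symmetric])
     (auto intro: L2_mult_integrable simp: algebra_simps)

lemma inner_scale_left: "l2_inner (\<lambda>x. c * f x) h = c * l2_inner f h"
  unfolding l2_inner_def by (simp add: mult.assoc)

lemma inner_cnj: "l2_inner f g = cnj (l2_inner g f)"
proof -
  have "cnj (l2_inner g f) = (LINT x|M01. cnj (g x * cnj (f x)))"
    unfolding l2_inner_def by (rule Bochner_Integration.integral_cnj[symmetric])
  then show ?thesis by (simp add: l2_inner_def mult.commute)
qed

lemma inner_scale_right: "l2_inner f (\<lambda>x. c * h x) = cnj c * l2_inner f h"
  using inner_cnj[of f "\<lambda>x. c * h x"] inner_cnj[of f h] by (simp add: inner_scale_left)

lemma inner_diff_left:
  "f \<in> L2 \<Longrightarrow> g \<in> L2 \<Longrightarrow> h \<in> L2 \<Longrightarrow>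
    l2_inner (\<lambda>x. f x - g x) h = l2_inner f h - l2_inner g h"
  using inner_add_left[OF _ L2_scale[of g "-1"], of f h] inner_scale_left[of "-1" g h] by simp

lemma inner_diff_right:
  "f \<in> L2 \<Longrightarrow> g \<in> L2 \<Longrightarrow> h \<in> L2 \<Longrightarrow>
    l2_inner h (\<lambda>x. f x - g x) = l2_inner h f - l2_inner h g"
  using inner_cnj[of h "\<lambda>x. f x - g x"] inner_cnj[of h f] inner_cnj[of h g]
  by (simp add: inner_diff_left)

lemma inner_sum_left:
  assumes "finite I" "\<And>i. i \<in> I \<Longrightarrow> f i \<in> L2" "h \<in> L2"
  shows "l2_inner (\<lambda>x. \<Sum>i\<in>I. c i * f i x) h = (\<Sum>i\<in>I. c i * l2_inner (f i) h)"
  using assms(1,2)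
proof (induction rule: finite_induct)
  case empty then show ?case by (simp add: l2_inner_def)
next
  case (insert i I)
  then have "l2_inner (\<lambda>x. c i * f i x + (\<Sum>i\<in>I. c i * f i x)) h
    = l2_inner (\<lambda>x. c i * f i x) h + l2_inner (\<lambda>x. \<Sum>i\<in>I. c i * f i x) h"
    using assms(3) by (intro inner_add_left L2_scale L2_sum) auto
  with insert show ?case by (simp add: inner_scale_left)
qed

lemma inner_sum_right:
  assumes "finite I" "\<And>i. i \<in> I \<Longrightarrow> f i \<in> L2" "h \<in> L2"
  shows "l2_inner h (\<lambda>x. \<Sum>i\<in>I. c i * f i x) = (\<Sum>i\<in>I. cnj (c i) * l2_inner h (f i))"
proof -
  have "cnj (l2_inner (\<lambda>x. \<Sum>i\<in>I. c i * f i x) h) = (\<Sum>i\<in>I. cnj (c i) * cnj (l2_inner (f i) h))"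
    by (simp add: inner_sum_left assms)
  then show ?thesis by (simp only: inner_cnj[symmetric])
qed

lemma inner_cong:
  assumes "f \<in> L2" "f' \<in> L2" "g \<in> L2" "g' \<in> L2" "ae_eq f f'" "ae_eq g g'"
  shows "l2_inner f g = l2_inner f' g'"
  unfolding l2_inner_def
proof (rule integral_cong_AE)
  show "(\<lambda>x. f x * cnj (g x)) \<in> borel_measurable M01" "(\<lambda>x. f' x * cnj (g' x)) \<in> borel_measurable M01"
    using assms(1-4)[THEN L2_measurable] by measurable
  show "AE x in M01. f x * cnj (g x) = f' x * cnj (g' x)"
    using assms(5,6) unfolding ae_eq_def by eventually_elim auto
qed

lemma inner_self: "l2_inner f f = of_real (LINT x|M01. (cmod (f x))\<^sup>2)"
proof -
  have "complex_of_real (LINT x|M01. (cmod (f x))\<^sup>2) = (LINT x|M01. of_real ((cmod (f x))\<^sup>2))"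
    by (rule integral_complex_of_real[symmetric])
  then show ?thesis by (simp only: l2_inner_def complex_norm_square)
qed

text \<open>A weighted form of the Cauchy-Schwarz inequality, from
  \<open>a * b \<le> t * a\<^sup>2 + b\<^sup>2 / t\<close> applied pointwise. The free weight
  \<open>t\<close> lets a limit argument make both terms small without taking square roots.\<close>

lemma inner_bound:
  assumes "f \<in> L2" "g \<in> L2" "t > 0"
  shows "cmod (l2_inner f g) \<le> t * Re (l2_inner f f) + Re (l2_inner g g) / t"
proof -
  have *: "a * b \<le> t * a\<^sup>2 + b\<^sup>2 / t" if "a \<ge> 0" "b \<ge> 0" for a b :: real
  proof -
    have "0 \<le> (t * a - b)\<^sup>2 + t * a * b" using that assms(3) by simp
    then have "t * (a * b) \<le> t * (t * a\<^sup>2) + b\<^sup>2"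
      by (simp add: power2_eq_square algebra_simps)
    then show ?thesis using assms(3) by (simp add: field_simps)
  qed
  have "cmod (l2_inner f g) \<le> (LINT x|M01. cmod (f x * cnj (g x)))"
    unfolding l2_inner_def by (rule integral_norm_bound)
  also have "\<dots> \<le> (LINT x|M01. t * (cmod (f x))\<^sup>2 + (cmod (g x))\<^sup>2 / t)"
    using assms *
    by (intro integral_mono integrable_norm L2_mult_integrable) (auto simp: norm_mult L2_integrable_sq)
  also have "\<dots> = t * Re (l2_inner f f) + Re (l2_inner g g) / t"
    using assms(1,2)[THEN L2_integrable_sq] by (simp add: inner_self)
  finally show ?thesis .
qed

subsection \<open>Moments\<close>

lemma mon_exp: "x > 0 \<Longrightarrow> mon s x = exp (s * of_real (ln x))"
  by (simp add: mon_def powr_def Ln_of_real)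

lemma mon_zero [simp]: "mon s 0 = 0"
  by (simp add: mon_def)

lemma norm_mon: "x \<ge> 0 \<Longrightarrow> cmod (mon s x) = x powr Re s"
  by (simp add: mon_def norm_powr_real_powr)

lemma mon_measurable [measurable]: "mon s \<in> borel_measurable M01"
proof -
  have *: "(\<lambda>x::real. if x = 0 then 0 else exp (s * of_real (ln x))) \<in> borel_measurable M01"
    by (intro measurable_M01_borel) measurable
  show ?thesis
  proof (rule measurable_cong[THEN iffD1, OF _ *])
    fix x assume "x \<in> space M01"
    then have "x \<ge> 0" by simp
    then show "(if x = 0 then 0 else exp (s * of_real (ln x))) = mon s x"
      by (cases "x = 0") (simp_all add: mon_exp)
  qed
qed

lemma mon_mult: "x \<ge> 0 \<Longrightarrow> mon s x * mon t x = mon (s + t) x"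
  by (cases "x = 0") (simp_all add: mon_exp exp_add algebra_simps)

lemma cnj_mon: "x \<ge> 0 \<Longrightarrow> cnj (mon s x) = mon (cnj s) x"
  by (cases "x = 0") (simp_all add: mon_exp exp_cnj)

lemma integrable_powr_M01: "p > -1 \<Longrightarrow> integrable M01 (\<lambda>x. x powr p)"
  unfolding integrable_M01_iff
  by (intro nonnegative_absolutely_integrable_1 integrable_on_powr_from_0) auto

text \<open>The estimate \<open>ln y \<le> y powr d / d\<close> at \<open>y = 1/x\<close> is raised
  to the power \<open>k\<close>. With \<open>d = e / Suc k\<close> this costs only
  \<open>x powr (- d * k)\<close>, and \<open>d * k < e\<close>; the successor also covers
  \<open>k = 0\<close>.\<close>

lemma abs_ln_power_bound:
  fixes x e :: real
  assumes "0 < x" "x \<le> 1" "e > 0"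
  shows "\<bar>ln x\<bar> ^ k \<le> (Suc k / e) ^ k * x powr (- e)"
proof -
  define d where "d = e / Suc k"
  have d: "d > 0" using assms by (simp add: d_def)
  have "ln (1/x) \<le> (1/x) powr d / d" using assms d by (intro ln_powr_bound) auto
  also have "(1/x) powr d = x powr (-d)" using assms by (simp add: powr_divide powr_minus_divide)
  finally have "\<bar>ln x\<bar> \<le> x powr (-d) / d" using assms by (simp add: ln_div)
  then have "\<bar>ln x\<bar> ^ k \<le> (x powr (-d) / d) ^ k" by (intro power_mono) auto
  also have "\<dots> = (1/d) ^ k * x powr (- d * k)"
    using assms by (simp add: power_divide powr_power mult.commute)
  also have "\<dots> \<le> (1/d) ^ k * x powr (- e)"
  proof (intro mult_left_mono powr_mono')
    show "- e \<le> - d * real k" using assms unfolding d_def by (simp add: field_simps)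
  qed (use assms d in auto)
  also have "1/d = Suc k / e" by (simp add: d_def)
  finally show ?thesis .
qed

lemma mon_ln_power_bound:
  assumes "0 \<le> x" "x \<le> 1" "e > 0"
  shows "cmod (mon p x * of_real (ln x) ^ k) \<le> (Suc k / e) ^ k * x powr (Re p - e)"
proof (cases "x = 0")
  case False
  then have x: "x > 0" using assms by simp
  have "cmod (mon p x * of_real (ln x) ^ k) = x powr Re p * \<bar>ln x\<bar> ^ k"
    using x by (simp add: norm_mult norm_power norm_mon)
  also have "\<dots> \<le> x powr Re p * ((Suc k / e) ^ k * x powr (- e))"
    using x assms by (intro mult_left_mono abs_ln_power_bound) auto
  also have "\<dots> = (Suc k / e) ^ k * x powr (Re p - e)"
    by (simp add: powr_diff powr_minus_divide)
  finally show ?thesis .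
qed (use assms in auto)

lemma integrable_mon_ln_power:
  assumes "Re p > -1"
  shows "integrable M01 (\<lambda>x. mon p x * of_real (ln x) ^ k)"
proof -
  \<comment> \<open>Half the distance from \<open>Re p\<close> to -1 absorbs the logarithms and
    keeps the exponent above -1.\<close>
  define e where "e = (Re p + 1) / 2"
  have e: "e > 0" "Re p - e > -1" using assms by (auto simp: e_def field_simps)
  show ?thesis
  proof (rule Bochner_Integration.integrable_bound)
    show "integrable M01 (\<lambda>x. (Suc k / e) ^ k * x powr (Re p - e))"
      using integrable_powr_M01[OF e(2)] by simp
    have "(\<lambda>x::real. complex_of_real (ln x) ^ k) \<in> borel_measurable M01"
      by (intro measurable_M01_borel) measurable
    then show "(\<lambda>x. mon p x * of_real (ln x) ^ k) \<in> borel_measurable M01" by measurable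
    have "norm (mon p x * of_real (ln x) ^ k) \<le> norm ((Suc k / e) ^ k * x powr (Re p - e))"
      if "x \<in> {0..1}" for x
      using mon_ln_power_bound[of x e p k] that e by (auto intro: order_trans)
    then show "AE x in M01. norm (mon p x * of_real (ln x) ^ k)
        \<le> norm ((Suc k / e) ^ k * x powr (Re p - e))"
      by (intro AE_I2) auto
  qed
qed

text \<open>At 0, part of the positive power absorbs the logarithms and the rest tends to 0.
  Continuity up to this endpoint is what the fundamental theorem of calculus needs in
  \<open>integral_mon_ln_power\<close>.\<close>

lemma continuous_mon_ln_power:
  assumes "Re p > 0"
  shows "continuous_on {0..1} (\<lambda>x. mon p x * of_real (ln x) ^ k)"
  unfolding continuous_on_eq_continuous_within
proof
  fix x :: real assume x: "x \<in> {0..1}"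
  show "continuous (at x within {0..1}) (\<lambda>x. mon p x * of_real (ln x) ^ k)"
  proof (cases "x = 0")
    case True
    define e where "e = Re p / 2"
    have e: "e > 0" "Re p - e > 0" using assms by (auto simp: e_def)
    have "((\<lambda>x. mon p x * of_real (ln x) ^ k) \<longlongrightarrow> 0) (at 0 within {0..1})"
    proof (rule tendsto_0_le[where K = 1])
      have "((\<lambda>x. x powr (Re p - e)) \<longlongrightarrow> 0 powr (Re p - e)) (at 0 within {0..1})"
        using e by (intro tendsto_powr' tendsto_intros) (auto simp: eventually_at_filter)
      then show "((\<lambda>x. (Suc k / e) ^ k * x powr (Re p - e)) \<longlongrightarrow> 0) (at 0 within {0..1})"
        by (auto intro: tendsto_mult_right_zero)
      have "norm (mon p x * of_real (ln x) ^ k) \<le> norm ((Suc k / e) ^ k * x powr (Re p - e)) * 1"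
        if "x \<in> {0..1}" for x
        using mon_ln_power_bound[of x e p k] that e by (auto intro: order_trans)
      then show "\<forall>\<^sub>F x in at 0 within {0..1}. norm (mon p x * of_real (ln x) ^ k)
          \<le> norm ((Suc k / e) ^ k * x powr (Re p - e)) * 1"
        by (simp add: eventually_at_filter)
    qed
    then show ?thesis using True by (simp add: continuous_within)
  next
    case False
    then have "x > 0" using x by simp
    then have cont: "isCont (\<lambda>x. exp (p * of_real (ln x)) * of_real (ln x) ^ k) x"
      by (intro continuous_intros) auto
    have eq: "\<forall>\<^sub>F y in nhds x. exp (p * of_real (ln y)) * of_real (ln y) ^ k
        = mon p y * of_real (ln y) ^ k"
      using \<open>x > 0\<close> by (intro eventually_nhds_in_open[THEN eventually_mono, of "{0<..}"])
        (auto simp: mon_exp)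
    have "isCont (\<lambda>x. mon p x * of_real (ln x) ^ k) x"
      using cont unfolding isCont_cong[OF eq] .
    then show ?thesis by (rule continuous_at_imp_continuous_at_within)
  qed
qed

text \<open>For \<open>k = 0\<close> the truncated exponent \<open>k - 1\<close> is harmless, since
  its term has the factor \<open>k\<close>.\<close>

lemma mon_ln_power_vector_derivative:
  assumes "x > 0"
  shows "((\<lambda>x. mon (p + 1) x * of_real (ln x) ^ k) has_vector_derivative
      (p + 1) * (mon p x * of_real (ln x) ^ k) + of_nat k * (mon p x * of_real (ln x) ^ (k - 1))) (at x)"
proof -
  have "((\<lambda>x. exp ((p + 1) * of_real (ln x)) * of_real (ln x) ^ k) has_vector_derivative
      (p + 1) * (mon p x * of_real (ln x) ^ k) + of_nat k * (mon p x * of_real (ln x) ^ (k - 1))) (at x)"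
  proof -
    have ln': "((\<lambda>x. complex_of_real (ln x)) has_vector_derivative of_real (1 / x)) (at x)"
      using assms by (intro has_vector_derivative_of_real)
        (auto intro!: derivative_eq_intros simp flip: has_real_derivative_iff_has_vector_derivative)
    have F: "((\<lambda>z. exp ((p + 1) * z) * z ^ k) has_field_derivative
        exp ((p + 1) * z) * (p + 1) * z ^ k + exp ((p + 1) * z) * (of_nat k * z ^ (k - 1))) (at z)" for z
      by (auto intro!: derivative_eq_intros simp: algebra_simps)
    have E: "exp ((p + 1) * of_real (ln x)) = mon p x * of_real x"
      using assms by (simp add: mon_exp ring_distribs exp_add exp_of_real)
    show ?thesis
      using field_vector_diff_chain_at[OF ln' F] unfolding o_def E
      by (rule has_vector_derivative_eq_rhs) (use assms in \<open>simp add: field_simps\<close>)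
  qed
  then show ?thesis
    by (rule has_vector_derivative_transform_within_open[of _ _ _ "{0<..}"])
       (use assms in \<open>auto simp: mon_exp\<close>)
qed

text \<open>Integrating the derivative of \<open>mon (p + 1) x * ln x ^ k\<close> gives a recursion
  in \<open>k\<close> that determines all these integrals.\<close>

lemma integral_mon_ln_power:
  assumes "Re p > -1"
  shows "(LINT x|M01. mon p x * of_real (ln x) ^ k) = (-1) ^ k * fact k / (1 + p) ^ Suc k"
proof -
  have p1: "Re (p + 1) > 0" "1 + p \<noteq> 0" using assms by (auto simp: complex_eq_iff)
  let ?F = "\<lambda>k x. (p + 1) * (mon p x * of_real (ln x) ^ k)
      + of_nat k * (mon p x * of_real (ln x) ^ (k - 1))"
  let ?I = "\<lambda>k. (LINT x|M01. mon p x * of_real (ln x) ^ k)"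
  \<comment> \<open>The boundary term at 0 vanishes because \<open>mon (p + 1) 0 = 0\<close>; the
    one at 1 is \<open>0 ^ k\<close>, which is 1 only for \<open>k = 0\<close>.\<close>
  have ftc: "(p + 1) * ?I k + of_nat k * ?I (k - 1) = (if k = 0 then 1 else 0)" for k
  proof -
    have int: "integrable M01 (?F k)"
      using integrable_mon_ln_power[OF assms] by auto
    have "(?F k has_integral mon (p + 1) 1 * of_real (ln 1) ^ k - mon (p + 1) 0 * of_real (ln 0) ^ k) {0..1}"
      using continuous_mon_ln_power[OF p1(1)] mon_ln_power_vector_derivative
      by (intro fundamental_theorem_of_calculus_interior) auto
    then have "(LINT x|M01. ?F k x) = mon (p + 1) 1 * of_real (ln 1) ^ k - mon (p + 1) 0 * of_real (ln 0) ^ k"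
      using lint_M01[OF int] by (simp add: integral_unique)
    also have "(LINT x|M01. ?F k x) = (p + 1) * ?I k + of_nat k * ?I (k - 1)"
      using integrable_mon_ln_power[OF assms] by simp
    finally show ?thesis by (auto simp: mon_def)
  qed
  have divq: "A = n * B / (1 + p)" if "(p + 1) * A = n * B" "1 + p \<noteq> 0" for A B n
    using that by (simp add: field_simps)
  show ?thesis
  proof (induction k)
    case 0
    have "(p + 1) * ?I 0 = 1 * 1" using ftc[of 0] by simp
    then have "?I 0 = 1 * 1 / (1 + p)" by (rule divq[OF _ p1(2)])
    then show ?case by simp
  next
    case (Suc k)
    have "(p + 1) * ?I (Suc k) = - of_nat (Suc k) * ?I k"
      using ftc[of "Suc k"] by (simp only: add_eq_0_iff2 nat.simps if_False diff_Suc_1 mult_minus_left)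
    then have "?I (Suc k) = - of_nat (Suc k) * ?I k / (1 + p)"
      by (rule divq[OF _ p1(2)])
    then show ?case unfolding Suc.IH by (simp add: algebra_simps)
  qed
qed

subsection \<open>The orthonormal system\<close>

text \<open>Up to the sign \<open>(-1) ^ n\<close>, this is the \<open>n\<close>-th forward
  difference at \<open>j\<close> of the polynomial \<open>x choose i\<close>; by Pascal's rule each
  difference lowers \<open>i\<close> by one.\<close>

lemma alternating_binomial_sum:
  "(\<Sum>k\<le>n. (-1) ^ k * of_nat (n choose k) * of_nat ((j + k) choose i) :: 'a::comm_ring_1)
    = (if n \<le> i then (-1) ^ n * of_nat (j choose (i - n)) else 0)"
proof (induction n arbitrary: i)
  case 0 then show ?case by simp
next
  case (Suc n)
  let ?g = "\<lambda>i k. of_nat ((j + k) choose i) :: 'a"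
  have "(\<Sum>k\<le>Suc n. (-1) ^ k * of_nat (Suc n choose k) * ?g i k)
      = ?g i 0 + (\<Sum>k\<le>n. (-1) ^ Suc k * of_nat (Suc n choose Suc k) * ?g i (Suc k))"
    by (subst sum.atMost_Suc_shift) simp
  also have "\<dots> = (?g i 0 + (\<Sum>k\<le>n. (-1) ^ Suc k * of_nat (n choose Suc k) * ?g i (Suc k)))
      - (\<Sum>k\<le>n. (-1) ^ k * of_nat (n choose k) * ?g i (Suc k))"
    by (simp add: algebra_simps sum.distrib sum_negf sum_subtractf)
  \<comment> \<open>The separated term for \<open>k = 0\<close> completes the row \<open>n\<close>
    again; its extra entry \<open>n choose Suc n\<close> is zero.\<close>
  also have "?g i 0 + (\<Sum>k\<le>n. (-1) ^ Suc k * of_nat (n choose Suc k) * ?g i (Suc k))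
      = (\<Sum>k\<le>Suc n. (-1) ^ k * of_nat (n choose k) * ?g i k)"
    by (simp only: sum.atMost_Suc_shift) simp
  also have "\<dots> = (\<Sum>k\<le>n. (-1) ^ k * of_nat (n choose k) * ?g i k)"
    by (simp add: binomial_eq_0)
  also have "\<dots> - (\<Sum>k\<le>n. (-1) ^ k * of_nat (n choose k) * ?g i (Suc k))
      = - (\<Sum>k\<le>n. (-1) ^ k * of_nat (n choose k) * (?g i (Suc k) - ?g i k))"
    by (simp add: algebra_simps sum_subtractf)
  also have "\<dots> = (if Suc n \<le> i then (-1) ^ Suc n * of_nat (j choose (i - Suc n)) else 0)"
  proof (cases i)
    case 0 then show ?thesis by simp
  next
    case (Suc i')
    then show ?thesis using Suc.IH[of i'] by simp
  qed
  finally show ?case .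
qed

lemma ln_power_L2: "(\<lambda>x. of_real (ln x) ^ k) \<in> L2"
proof (rule L2_bound)
  show "(\<lambda>x. complex_of_real (ln x) ^ k) \<in> borel_measurable M01"
    by (intro measurable_M01_borel) measurable
  show "integrable M01 (\<lambda>x. cmod (mon 0 x * of_real (ln x) ^ (2 * k)))"
    by (intro integrable_norm integrable_mon_ln_power) simp
  show "AE x in M01. (cmod (of_real (ln x) ^ k))\<^sup>2 \<le> cmod (mon 0 x * of_real (ln x) ^ (2 * k))"
    using AE_M01_pos by eventually_elim (simp add: mon_exp norm_power power_mult[symmetric] mult.commute)
qed

lemma e_basis_sum:
  "e_basis n = (\<lambda>x. \<Sum>k\<le>n. (of_nat (n choose k) / fact k) * of_real (ln x) ^ k)"
  by (simp add: e_basis_def)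

lemma e_basis_L2: "e_basis n \<in> L2"
  unfolding e_basis_sum by (intro L2_sum L2_scale ln_power_L2) auto

lemma mon_L2: "Re s > -1/2 \<Longrightarrow> mon s \<in> L2"
proof (rule L2_bound)
  assume "Re s > -1/2"
  then show "integrable M01 (\<lambda>x. x powr (2 * Re s))" by (intro integrable_powr_M01) auto
  show "AE x in M01. (cmod (mon s x))\<^sup>2 \<le> x powr (2 * Re s)"
    using AE_M01_pos by eventually_elim (simp add: norm_mon powr_power mult.commute)
qed simp

text \<open>The moments are \<open>(-1) ^ (j + k) * fact (j + k)\<close>, so cancelling factorials
  leaves an alternating binomial sum. It vanishes for \<open>j < n\<close>, which is the source of
  orthogonality.\<close>

lemma inner_ln_power_e_basis:
  "l2_inner (\<lambda>x. of_real (ln x) ^ j) (e_basis n) = (-1) ^ (j + n) * fact j * of_nat (j choose n)"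
proof -
  have ip: "l2_inner (\<lambda>x. of_real (ln x) ^ j) (\<lambda>x. of_real (ln x) ^ k) = (-1) ^ (j + k) * fact (j + k)" for k
  proof -
    have "l2_inner (\<lambda>x. of_real (ln x) ^ j) (\<lambda>x. of_real (ln x) ^ k)
        = (LINT x|M01. mon 0 x * of_real (ln x) ^ (j + k))"
      unfolding l2_inner_def
    proof (rule integral_cong_AE)
      show "(\<lambda>x. mon 0 x * complex_of_real (ln x) ^ (j + k)) \<in> borel_measurable M01"
        by (intro borel_measurable_integrable integrable_mon_ln_power) simp
      show "(\<lambda>x. complex_of_real (ln x) ^ j * cnj (of_real (ln x) ^ k)) \<in> borel_measurable M01"
        by (intro borel_measurable_integrable L2_mult_integrable ln_power_L2)
      show "AE x in M01. complex_of_real (ln x) ^ j * cnj (of_real (ln x) ^ k)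
          = mon 0 x * of_real (ln x) ^ (j + k)"
        using AE_M01_pos by eventually_elim (simp add: mon_exp power_add)
    qed
    also have "\<dots> = (-1) ^ (j + k) * fact (j + k)"
      by (subst integral_mon_ln_power) auto
    finally show ?thesis .
  qed
  have "l2_inner (\<lambda>x. of_real (ln x) ^ j) (e_basis n)
      = (\<Sum>k\<le>n. (of_nat (n choose k) / fact k) * ((-1) ^ (j + k) * fact (j + k)))"
    unfolding e_basis_sum by (subst inner_sum_right) (auto simp: ln_power_L2 ip)
  also have "\<dots> = (\<Sum>k\<le>n. (-1) ^ j * fact j * ((-1) ^ k * of_nat (n choose k) * of_nat ((j + k) choose j)))"
  proof (intro sum.cong refl)
    fix k
    have "of_nat ((j + k) choose j) = (fact (j + k) / (fact j * fact k) :: complex)"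
      by (subst binomial_fact) auto
    then show "(of_nat (n choose k) / fact k) * ((-1) ^ (j + k) * fact (j + k))
      = (-1) ^ j * fact j * ((-1) ^ k * of_nat (n choose k) * of_nat ((j + k) choose j) :: complex)"
      by (simp add: power_add)
  qed
  also have "\<dots> = (-1) ^ j * fact j * (if n \<le> j then (-1) ^ n * of_nat (j choose (j - n)) else 0)"
    by (simp add: sum_distrib_left[symmetric] alternating_binomial_sum)
  also have "\<dots> = (-1) ^ (j + n) * fact j * of_nat (j choose n)"
    by (auto simp: power_add binomial_symmetric[symmetric])
  finally show ?thesis .
qed

lemma e_basis_orthonormal: "l2_inner (e_basis m) (e_basis n) = (if m = n then 1 else 0)"
proof -
  have "l2_inner (e_basis m) (e_basis n)
      = (\<Sum>k\<le>m. (of_nat (m choose k) / fact k) * ((-1) ^ (k + n) * fact k * of_nat (k choose n)))"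
    unfolding e_basis_sum[of m]
    by (subst inner_sum_left) (auto simp: ln_power_L2 e_basis_L2 inner_ln_power_e_basis)
  also have "\<dots> = (\<Sum>k\<le>m. (-1) ^ n * ((-1) ^ k * of_nat (m choose k) * of_nat ((0 + k) choose n)))"
    by (intro sum.cong refl) (simp add: power_add)
  also have "\<dots> = (-1) ^ n * (if m \<le> n then (-1) ^ m * of_nat (0 choose (n - m)) else 0)"
    by (simp only: sum_distrib_left[symmetric] alternating_binomial_sum)
  also have "\<dots> = (if m = n then 1 else 0)"
    by (cases "n - m") (auto simp: power_add[symmetric])
  finally show ?thesis .
qed

text \<open>The binomial theorem for \<open>1 - 1 / (1 + s)\<close>. With \<open>s = u - 1/2\<close>
  the coefficients are geometric, and their ratio is the disc coordinate
  \<open>(u - 1/2) / (u + 1/2)\<close>.\<close>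

lemma inner_mon_e_basis:
  assumes "Re s > -1/2"
  shows "l2_inner (mon s) (e_basis n) = s ^ n / (1 + s) ^ Suc n"
proof -
  have s: "1 + s \<noteq> 0" using assms by (auto simp: complex_eq_iff)
  have ip: "l2_inner (mon s) (\<lambda>x. of_real (ln x) ^ k) = (-1) ^ k * fact k / (1 + s) ^ Suc k" for k
    using integral_mon_ln_power[of s k] assms by (simp add: l2_inner_def)
  have "l2_inner (mon s) (e_basis n)
      = (\<Sum>k\<le>n. (of_nat (n choose k) / fact k) * ((-1) ^ k * fact k / (1 + s) ^ Suc k))"
    unfolding e_basis_sum by (subst inner_sum_right) (use assms in \<open>auto simp: ln_power_L2 mon_L2 ip\<close>)
  also have "\<dots> = (\<Sum>k\<le>n. of_nat (n choose k) * (- 1 / (1 + s)) ^ k * 1 ^ (n - k)) / (1 + s)"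
    unfolding sum_divide_distrib power_divide by (intro sum.cong refl) simp
  also have "\<dots> = (- 1 / (1 + s) + 1) ^ n / (1 + s)" by (subst binomial_ring[symmetric]) simp
  also have "- 1 / (1 + s) + 1 = s / (1 + s)" using s by (simp add: field_simps)
  finally show ?thesis by (simp add: power_divide)
qed

lemma inner_mon_mon:
  assumes "Re s > -1/2" "Re t > -1/2"
  shows "l2_inner (mon s) (mon t) = 1 / (1 + s + cnj t)"
proof -
  have "l2_inner (mon s) (mon t) = (LINT x|M01. mon (s + cnj t) x * of_real (ln x) ^ 0)"
    unfolding l2_inner_def
    by (intro Bochner_Integration.integral_cong refl) (simp add: cnj_mon mon_mult)
  also have "\<dots> = 1 / (1 + s + cnj t)"
    by (subst integral_mon_ln_power) (use assms in \<open>auto simp: add.assoc\<close>)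
  finally show ?thesis .
qed

subsection \<open>The Mellin transform\<close>

text \<open>The exponent is centred so that the domain is the right half-plane; the transform is
  antiholomorphic in the parameter.\<close>

definition mellin :: "(real \<Rightarrow> complex) \<Rightarrow> complex \<Rightarrow> complex" where
  "mellin f u = l2_inner f (mon (u - 1/2))"

text \<open>The partial expansions of \<open>mon (u - 1/2)\<close> converge in norm, because their
  Parseval sum is a geometric series with the right value; pairing with \<open>f\<close> gives the
  series. Up to a factor, the transform is thus a power series in the conjugate disc
  coordinate.\<close>

lemma mellin_e_basis_sums:
  assumes f: "f \<in> L2" and u: "Re u > 0"
  shows "(\<lambda>n. l2_inner f (e_basis n) * cnj ((u - 1/2) / (u + 1/2)) ^ n) sums (cnj (u + 1/2) * mellin f u)"
proof -
  define s where "s = u - 1/2"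
  have s: "Re s > -1/2" "1 + s = u + 1/2" using u by (auto simp: s_def)
  have u1: "u + 1/2 \<noteq> 0" using u by (auto simp: complex_eq_iff)
  define c where "c = (\<lambda>n. l2_inner (mon s) (e_basis n))"
  have c: "c n = ((u - 1/2) / (u + 1/2)) ^ n / (u + 1/2)" for n
    using inner_mon_e_basis[OF s(1), of n] by (simp add: c_def s(2) power_divide) (simp add: s_def)
  define p where "p = (\<lambda>N x. \<Sum>n<N. c n * e_basis n x)"
  define r where "r = (\<lambda>N x. mon s x - p N x)"
  have monL: "mon s \<in> L2" using s by (simp add: mon_L2)
  have pL: "p N \<in> L2" for N unfolding p_def by (intro L2_sum L2_scale e_basis_L2) auto
  have rL: "r N \<in> L2" for N unfolding r_def by (intro L2_diff monL pL)
  have ip: "l2_inner g (p N) = (\<Sum>n<N. cnj (c n) * l2_inner g (e_basis n))" if "g \<in> L2" for g N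
    unfolding p_def by (intro inner_sum_right that e_basis_L2) auto
  have pe: "l2_inner (p N) (e_basis n) = c n" if "n < N" for n N
  proof -
    have "l2_inner (p N) (e_basis n) = (\<Sum>m<N. c m * (if m = n then 1 else 0))"
      unfolding p_def by (subst inner_sum_left) (auto simp: e_basis_L2 e_basis_orthonormal)
    also have "\<dots> = (\<Sum>m<N. if m = n then c m else 0)" by (intro sum.cong) auto
    also have "\<dots> = c n" using that by (simp add: sum.delta)
    finally show ?thesis .
  qed
  \<comment> \<open>The remainder is orthogonal to every basis function already used, hence to the
    partial sum.\<close>
  have rp: "l2_inner (r N) (p N) = 0" for N
  proof -
    have "l2_inner (r N) (e_basis n) = 0" if "n < N" for n
      unfolding r_def by (subst inner_diff_left) (use that pe in \<open>auto simp: monL pL e_basis_L2 c_def\<close>)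
    then show ?thesis by (simp add: ip rL)
  qed
  have rr: "Re (l2_inner (r N) (r N)) = 1 / (2 * Re u) - (\<Sum>n<N. (cmod (c n))\<^sup>2)" for N
  proof -
    have "l2_inner (r N) (r N) = l2_inner (r N) (mon s) - l2_inner (r N) (p N)"
      by (subst (2) r_def) (intro inner_diff_right monL pL rL)
    also have "\<dots> = l2_inner (mon s) (mon s) - l2_inner (p N) (mon s)"
      unfolding rp by (subst r_def) (simp add: inner_diff_left monL pL)
    also have "l2_inner (p N) (mon s) = (\<Sum>n<N. c n * cnj (c n))"
      unfolding p_def c_def
      by (subst inner_sum_left) (auto simp: e_basis_L2 monL simp flip: inner_cnj)
    also have "l2_inner (mon s) (mon s) = 1 / (1 + s + cnj s)"
      using s by (intro inner_mon_mon)
    also have "1 + s + cnj s = of_real (2 * Re u)" by (simp add: s_def complex_eq_iff)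
    finally have "l2_inner (r N) (r N) = 1 / of_real (2 * Re u) - (\<Sum>n<N. of_real ((cmod (c n))\<^sup>2))"
      by (simp only: complex_norm_square)
    then show ?thesis by (simp add: Re_divide power2_eq_square)
  qed
  have "(\<lambda>n. (cmod (c n))\<^sup>2) sums (1 / (2 * Re u))"
  proof -
    let ?q = "(cmod (u - 1/2) / cmod (u + 1/2))\<^sup>2"
    have n0: "(cmod (u + 1/2))\<^sup>2 > 0" using u1 by simp
    \<comment> \<open>This difference makes the geometric ratio less than 1 and turns the sum into
      \<open>1 / (2 * Re u)\<close>, the squared norm of \<open>mon s\<close>.\<close>
    have d: "(cmod (u + 1/2))\<^sup>2 - (cmod (u - 1/2))\<^sup>2 = 2 * Re u"
      unfolding cmod_power2 by (simp add: power2_eq_square algebra_simps)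
    then have "(cmod (u - 1/2))\<^sup>2 < (cmod (u + 1/2))\<^sup>2" using u by simp
    then have "?q < 1" using n0 by (simp add: power_divide)
    then have "(\<lambda>n. ?q ^ n / (cmod (u + 1/2))\<^sup>2) sums (1 / (1 - ?q) / (cmod (u + 1/2))\<^sup>2)"
      by (intro sums_divide geometric_sums) auto
    also have "(\<lambda>n. ?q ^ n / (cmod (u + 1/2))\<^sup>2) = (\<lambda>n. (cmod (c n))\<^sup>2)"
      by (rule ext) (simp add: c norm_divide norm_power norm_mult power_divide power_mult[symmetric]
          power_mult_distrib mult.commute)
    also have "1 / (1 - ?q) / (cmod (u + 1/2))\<^sup>2 = 1 / (2 * Re u)"
    proof -
      have "1 / (1 - Y / X) / X = 1 / (X - Y)" if "X > 0" for X Y :: real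
        using that by (simp add: left_diff_distrib)
      from this[OF n0] show ?thesis unfolding d[symmetric] power_divide .
    qed
    finally show ?thesis .
  qed
  then have "(\<lambda>N. 1 / (2 * Re u) - (\<Sum>n<N. (cmod (c n))\<^sup>2)) \<longlonglongrightarrow> 1 / (2 * Re u) - 1 / (2 * Re u)"
    unfolding sums_def by (intro tendsto_intros)
  then have rr0: "(\<lambda>N. Re (l2_inner (r N) (r N))) \<longlonglongrightarrow> 0" unfolding rr by simp
  have lim0: "(\<lambda>N. l2_inner f (r N)) \<longlonglongrightarrow> 0"
  proof (rule LIMSEQ_I)
    fix e :: real assume e: "e > 0"
    define A where "A = Re (l2_inner f f)"
    have A: "A \<ge> 0" unfolding A_def inner_self by simp
    \<comment> \<open>The weight keeps the first term of \<open>inner_bound\<close> below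
      \<open>e / 2\<close>, and the second is small for large \<open>N\<close>; adding 1 covers
      \<open>A = 0\<close>.\<close>
    define t where "t = e / (2 * (A + 1))"
    have t: "t > 0" "t * A < e / 2" using e A by (auto simp: t_def field_simps)
    have "\<forall>\<^sub>F N in sequentially. Re (l2_inner (r N) (r N)) < t * (e / 2)"
      using rr0 t e by (intro order_tendstoD) auto
    then obtain N0 where N0: "\<And>N. N \<ge> N0 \<Longrightarrow> Re (l2_inner (r N) (r N)) < t * (e / 2)"
      by (auto simp: eventually_sequentially)
    have "norm (l2_inner f (r N) - 0) < e" if "N \<ge> N0" for N
    proof -
      have "cmod (l2_inner f (r N)) \<le> t * A + Re (l2_inner (r N) (r N)) / t"
        unfolding A_def by (intro inner_bound f rL t)
      moreover have "Re (l2_inner (r N) (r N)) / t < e / 2"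
        using N0[OF that] t by (simp add: field_simps)
      ultimately show ?thesis using t(2) unfolding diff_0_right by linarith
    qed
    then show "\<exists>no. \<forall>n\<ge>no. norm (l2_inner f (r n) - 0) < e" by blast
  qed
  have fr: "l2_inner f (r N) = mellin f u - (\<Sum>n<N. cnj (c n) * l2_inner f (e_basis n))" for N
    unfolding r_def mellin_def s_def[symmetric]
    by (subst inner_diff_right) (auto simp: f monL pL ip)
  have "(\<lambda>N. mellin f u - l2_inner f (r N)) \<longlonglongrightarrow> mellin f u - 0"
    by (intro tendsto_intros lim0)
  then have "(\<lambda>n. cnj (c n) * l2_inner f (e_basis n)) sums mellin f u"
    unfolding fr sums_def by simp
  then have "(\<lambda>n. cnj (u + 1/2) * (cnj (c n) * l2_inner f (e_basis n))) sums (cnj (u + 1/2) * mellin f u)"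
    by (rule sums_mult)
  moreover have "cnj (u + 1/2) * (cnj (c n) * l2_inner f (e_basis n))
      = l2_inner f (e_basis n) * cnj ((u - 1/2) / (u + 1/2)) ^ n" for n
  proof -
    have "cnj w * (cnj (z ^ n / w) * q) = q * cnj z ^ n" if "w \<noteq> 0" for w z q
      using that by simp
    from this[OF u1] show ?thesis unfolding c .
  qed
  ultimately show ?thesis by (simp only:)
qed

lemma mellin_cong: "f \<in> L2 \<Longrightarrow> g \<in> L2 \<Longrightarrow> ae_eq f g \<Longrightarrow> Re u > 0 \<Longrightarrow> mellin f u = mellin g u"
  unfolding mellin_def by (intro inner_cong mon_L2) (auto simp: ae_eq_def)

lemma mellin_scale: "mellin (\<lambda>x. c * f x) u = c * mellin f u"
  by (simp add: mellin_def inner_scale_left)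

text \<open>A nonzero coefficient of positive index would give a punctured disc about 0 free of
  zeros. The constant term is read off at \<open>z = 0\<close>.\<close>

lemma powser_zero_imp_coeff_zero:
  fixes a :: "nat \<Rightarrow> complex"
  assumes "\<And>z. norm z < 1 \<Longrightarrow> (\<lambda>n. a n * z ^ n) sums 0"
  shows "a n = 0"
proof (cases "n = 0")
  case True
  then show ?thesis using assms[of 0] by (simp add: sums_iff)
next
  case False
  show ?thesis
  proof (rule ccontr)
    assume "a n \<noteq> 0"
    show False
    proof (rule powser_0_nonzero[of 1 0 a "\<lambda>_. 0" n])
      fix s :: real
      assume "0 < s" and s: "\<And>z::complex. z \<in> cball 0 s - {0} \<Longrightarrow> (0::complex) \<noteq> 0"
      then show False using s[of "of_real s"] by simp
    qed (use assms False \<open>a n \<noteq> 0\<close> in auto)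
  qed
qed

text \<open>In the disc coordinate \<open>z = (u - 1/2) / (u + 1/2)\<close>, the map \<open>u \<mapsto> 1 / (4 u)\<close> is \<open>z \<mapsto> -z\<close>.\<close>

lemma J_mellin_iff:
  assumes f: "f \<in> L2" and g: "g \<in> L2"
  shows "(\<forall>n. l2_inner g (e_basis n) = (-1) ^ n * l2_inner f (e_basis n)) \<longleftrightarrow>
    (\<forall>u. Re u > 0 \<longrightarrow> mellin g u = cnj (1 / (2 * u)) * mellin f (1 / (4 * u)))"
    (is "?L \<longleftrightarrow> ?R")
proof -
  let ?z = "\<lambda>u. (u - 1/2) / (u + 1/2) :: complex"
  \<comment> \<open>The inversion negates the disc coordinate, and the coefficients absorb the sign.
    The prefactors agree by \<open>1 / (4 * u) + 1/2 = (u + 1/2) / (2 * u)\<close>.\<close>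
  have J: "(\<lambda>n. ((-1) ^ n * l2_inner f (e_basis n)) * cnj (?z u) ^ n) sums
      (cnj (u + 1/2) * (cnj (1 / (2 * u)) * mellin f (1 / (4 * u))))" if u: "Re u > 0" for u
  proof -
    have u0: "u \<noteq> 0" "u + 1/2 \<noteq> 0" "1/2 + u \<noteq> 0" "2 * u + 1 \<noteq> 0" "1 + 2 * u \<noteq> 0" "2 + u * 4 \<noteq> 0"
      using u by (auto simp: complex_eq_iff)
    have "Re (1 / (4 * u)) > 0" using u by (simp add: Re_divide add_pos_nonneg)
    from mellin_e_basis_sums[OF f this]
    have "(\<lambda>n. l2_inner f (e_basis n) * cnj (?z (1 / (4 * u))) ^ n) sums
        (cnj (1 / (4 * u) + 1/2) * mellin f (1 / (4 * u)))" .
    moreover have "?z (1 / (4 * u)) = - ?z u"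
      using u0 by (simp add: divide_simps) (simp add: algebra_simps)
    moreover have "1 / (4 * u) + 1/2 = (u + 1/2) * (1 / (2 * u))"
      using u0 by (simp add: field_simps)
    ultimately show ?thesis
      by (simp only: complex_cnj_mult complex_cnj_minus power_minus[of "cnj _"] mult.assoc mult.left_commute)
  qed
  show ?thesis
  proof
    assume L: ?L
    show ?R
    proof (intro allI impI)
      fix u assume u: "Re u > 0"
      have "cnj (u + 1/2) \<noteq> 0" using u by (auto simp: complex_eq_iff)
      moreover have "cnj (u + 1/2) * mellin g u = cnj (u + 1/2) * (cnj (1 / (2 * u)) * mellin f (1 / (4 * u)))"
        using mellin_e_basis_sums[OF g u] J[OF u] L by (simp only: sums_unique2)
      ultimately show "mellin g u = cnj (1 / (2 * u)) * mellin f (1 / (4 * u))"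
        by (simp only: mult_cancel_left simp_thms)
    qed
  next
    assume R: ?R
    have "(\<lambda>n. (l2_inner g (e_basis n) - (-1) ^ n * l2_inner f (e_basis n)) * z ^ n) sums 0"
      if z: "norm z < 1" for z
    proof -
      define w where "w = cnj z"
      \<comment> \<open>This inverts the disc coordinate at \<open>w\<close>, the conjugate of
        \<open>z\<close>, because the series runs in the conjugate coordinate.\<close>
      define u where "u = (1 + w) / (2 * (1 - w))"
      have w: "norm w < 1" using z by (simp add: w_def)
      have w1: "1 - w \<noteq> 0" using w by auto
      have u: "Re u > 0"
      proof -
        have "(cmod w)\<^sup>2 < 1" using w by (simp add: power_less_one_iff abs_square_less_1)
        then have "(1 + Re w) * (1 - Re w) - Im w * Im w > 0"
          unfolding cmod_power2 by (simp add: power2_eq_square algebra_simps)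
        moreover have "(1 - Re w)\<^sup>2 + (Im w)\<^sup>2 > 0"
          using w1 by (auto simp: complex_eq_iff sum_power2_gt_zero_iff)
        moreover have "Re u = ((1 + Re w) * (1 - Re w) - Im w * Im w) / (2 * ((1 - Re w)\<^sup>2 + (Im w)\<^sup>2))"
          unfolding u_def Re_divide by (simp add: power2_eq_square divide_simps) (simp add: algebra_simps)
        ultimately show ?thesis by simp
      qed
      have "?z u = w" using w1 by (simp add: u_def divide_simps)
      then have zu: "cnj (?z u) = z" by (simp add: w_def)
      show ?thesis
        using sums_diff[OF mellin_e_basis_sums[OF g u] J[OF u]] R u
        unfolding zu by (simp add: algebra_simps)
    qed
    then have "l2_inner g (e_basis n) - (-1) ^ n * l2_inner f (e_basis n) = 0" for n
      by (rule powser_zero_imp_coeff_zero)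
    then show ?L by simp
  qed
qed

section \<open>Injectivity of the Mellin transform\<close>

text \<open>Orthogonality to all powers extends to polynomials, and by uniform approximation
  (Stone-Weierstrass) to continuous functions.\<close>

lemma inner_continuous_zero:
  assumes h: "h \<in> L2" and z: "\<And>n::nat. l2_inner h (mon (of_nat n)) = 0"
    and c: "continuous_on {0..1} \<phi>"
  shows "(LINT x|M01. h x * of_real (\<phi> x)) = 0"
proof -
  have mono: "(LINT x|M01. h x * of_real (x ^ n)) = 0" for n
  proof -
    have "(LINT x|M01. h x * of_real (x ^ n)) = l2_inner h (mon (of_nat n))"
      unfolding l2_inner_def
    proof (rule integral_cong_AE)
      show "(\<lambda>x. h x * of_real (x ^ n)) \<in> borel_measurable M01"
        by (intro borel_measurable_times L2_measurable[OF h] measurable_M01_borel) measurable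
      show "(\<lambda>x. h x * cnj (mon (of_nat n) x)) \<in> borel_measurable M01"
        using L2_measurable[OF h] by measurable
      show "AE x in M01. h x * of_real (x ^ n) = h x * cnj (mon (of_nat n) x)"
        using AE_M01_pos by eventually_elim (simp add: mon_def powr_nat)
    qed
    with z show ?thesis by simp
  qed
  have poly: "(LINT x|M01. h x * of_real (g x)) = 0" if pg: "real_polynomial_function g" for g
  proof -
    obtain a n where g: "g = (\<lambda>x. \<Sum>i\<le>n. a i * x ^ i)"
      using pg[unfolded real_polynomial_function_iff_sum] by blast
    have "integrable M01 (\<lambda>x. h x * of_real (x ^ i))" for i
      using L2_integrable[OF h]
    proof (rule Bochner_Integration.integrable_bound)
      show "(\<lambda>x. h x * of_real (x ^ i)) \<in> borel_measurable M01"
        by (intro borel_measurable_times L2_measurable[OF h] measurable_M01_borel) measurable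
      show "AE x in M01. norm (h x * of_real (x ^ i)) \<le> norm (h x)"
        using AE_M01_pos by eventually_elim
          (auto simp: norm_mult norm_power intro!: mult_right_le_one_le power_le_one)
    qed
    then have "(LINT x|M01. (\<Sum>i\<le>n. of_real (a i) * (h x * of_real (x ^ i)))) = 0"
      using mono by (subst Bochner_Integration.integral_sum) auto
    then show ?thesis by (simp add: g sum_distrib_left algebra_simps)
  qed
  have hi: "integrable M01 h" by (rule L2_integrable[OF h])
  define A where "A = (LINT x|M01. norm (h x))"
  have A: "A \<ge> 0" by (simp add: A_def)
  have cm: "continuous_on {0..1} \<psi> \<Longrightarrow> (\<lambda>x. h x * of_real (\<psi> x)) \<in> borel_measurable M01" for \<psi>
    by (intro borel_measurable_times[OF L2_measurable[OF h]] borel_measurable_of_real continuous_imp_measurable_on_sets_lebesgue) auto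
  have "norm (LINT x|M01. h x * of_real (\<phi> x)) \<le> e" if e: "e > 0" for e
  proof -
    \<comment> \<open>The tolerance is scaled by the integral \<open>A\<close> of the modulus of
      \<open>h\<close>; adding 1 keeps the denominator positive.\<close>
    obtain g where g: "real_polynomial_function g" "\<And>x. x \<in> {0..1} \<Longrightarrow> \<bar>\<phi> x - g x\<bar> < e / (A + 1)"
      using Stone_Weierstrass_real_polynomial_function[OF compact_Icc c, of "e / (A + 1)"] e A by auto
    have gc: "continuous_on {0..1} g"
      using g(1) by (simp add: continuous_on_polymonial_function real_polynomial_function_eq)
    have bd: "integrable M01 (\<lambda>x. h x * of_real (\<psi> x))" if ct: "continuous_on {0..1} \<psi>" for \<psi>
    proof -
      obtain B where B: "\<forall>x\<in>{0..1}. \<bar>\<psi> x\<bar> \<le> B"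
        using compact_imp_bounded[OF compact_continuous_image[OF ct compact_Icc]]
        by (auto simp: bounded_iff)
      have "integrable M01 (\<lambda>x. of_real B * h x)" using hi by simp
      then show ?thesis
      proof (rule Bochner_Integration.integrable_bound)
        have "norm (h x * of_real (\<psi> x)) \<le> norm (of_real B * h x)" if "x \<in> {0..1}" for x
          using bspec[OF B that] by (auto simp: norm_mult mult.commute intro!: mult_mono)
        then show "AE x in M01. norm (h x * of_real (\<psi> x)) \<le> norm (of_real B * h x)"
          by (intro AE_I2) simp
      qed (rule cm[OF ct])
    qed
    have "(LINT x|M01. h x * of_real (\<phi> x)) = (LINT x|M01. h x * of_real (\<phi> x) - h x * of_real (g x))"
      using bd[OF c] bd[OF gc] poly[OF g(1)] by simp
    also have "norm \<dots> \<le> (LINT x|M01. norm (h x * of_real (\<phi> x) - h x * of_real (g x)))"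
      by (rule integral_norm_bound)
    also have "\<dots> \<le> (LINT x|M01. e / (A + 1) * norm (h x))"
    proof (intro integral_mono integrable_norm Bochner_Integration.integrable_diff bd c gc)
      fix x assume "x \<in> space M01"
      then have "\<bar>\<phi> x - g x\<bar> \<le> e / (A + 1)" using g(2)[of x] by simp
      moreover have "norm (h x * of_real (\<phi> x) - h x * of_real (g x)) = norm (h x) * \<bar>\<phi> x - g x\<bar>"
        by (simp add: norm_mult right_diff_distrib[symmetric] of_real_diff[symmetric] del: of_real_diff)
      ultimately show "norm (h x * of_real (\<phi> x) - h x * of_real (g x)) \<le> e / (A + 1) * norm (h x)"
        by (metis mult.commute mult_left_mono norm_ge_zero)
    qed (use hi in auto)
    also have "\<dots> = e / (A + 1) * A" by (simp add: A_def)
    also have "\<dots> \<le> e" using A e by (simp add: field_simps)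
    finally show ?thesis .
  qed
  then have "norm (LINT x|M01. h x * of_real (\<phi> x)) \<le> 0"
    by (rule dense_ge)
  then show ?thesis by (simp only: norm_le_zero_iff)
qed

text \<open>The points \<open>u = n + 1/2\<close> give the powers of \<open>x\<close>, so
  \<open>h\<close> integrates to zero against continuous functions. These approximate indicators
  almost everywhere, hence \<open>h\<close> has zero integral over each measurable set.\<close>

lemma mellin_zero_imp_ae_zero:
  assumes h: "h \<in> L2" and z: "\<And>u. Re u > 0 \<Longrightarrow> mellin h u = 0"
  shows "AE x in M01. h x = 0"
proof (rule sigma_finite_measure.density_zero)
  show "sigma_finite_measure M01"
    by (intro finite_measure.axioms(1) finite_measure_lebesgue_on) auto
  show hi: "integrable M01 h" by (rule L2_integrable[OF h])
  fix A assume "A \<in> sets M01"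
  then have A: "A \<in> sets lebesgue" "A \<subseteq> {0..1}" by (auto simp: sets_restrict_space)
  have z': "l2_inner h (mon (of_nat n)) = 0" for n
    using z[of "of_nat n + 1/2"] by (simp add: mellin_def)
  have "indicat_real A \<in> borel_measurable lebesgue" using A by simp
  then have "indicat_real A measurable_on UNIV"
    using sets.top[of "lebesgue :: real measure"]
    by (intro lebesgue_measurable_imp_measurable_on) simp_all
  then obtain N g where N: "negligible N" and gc: "\<And>n::nat. continuous_on UNIV (g n)"
    and lim: "\<And>x. x \<notin> N \<Longrightarrow> (\<lambda>n. g n x) \<longlonglongrightarrow> indicat_real A x"
    by (auto simp: measurable_on_def)
  \<comment> \<open>Truncating to values in \<open>[0,1]\<close> provides the dominating function
    \<open>norm (h x)\<close> and keeps the limit.\<close>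
  define k where "k = (\<lambda>n x. max 0 (min 1 (g n x)))"
  have kc: "continuous_on {0..1} (k n)" for n
    unfolding k_def by (intro continuous_intros continuous_on_subset[OF gc]) auto
  have "(\<lambda>n. LINT x|M01. h x * of_real (k n x)) \<longlonglongrightarrow> (LINT x|M01. h x * of_real (indicat_real A x))"
  proof (rule integral_dominated_convergence)
    show "integrable M01 (\<lambda>x. norm (h x))" using hi by simp
    show "(\<lambda>x. h x * of_real (indicat_real A x)) \<in> borel_measurable M01"
      using \<open>A \<in> sets M01\<close>
      by (intro borel_measurable_times L2_measurable[OF h] borel_measurable_of_real) simp
    show "(\<lambda>x. h x * of_real (k n x)) \<in> borel_measurable M01" for n
      using kc by (intro borel_measurable_times[OF L2_measurable[OF h]] borel_measurable_of_real continuous_imp_measurable_on_sets_lebesgue) auto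
    have "AE x in lebesgue. x \<notin> N" using N by (simp add: AE_not_in negligible_iff_null_sets)
    then have "AE x in M01. x \<notin> N" by (subst AE_restrict_space_iff) auto
    then show "AE x in M01. (\<lambda>n. h x * of_real (k n x)) \<longlonglongrightarrow> h x * of_real (indicat_real A x)"
    proof eventually_elim
      case (elim x)
      have "(\<lambda>n. k n x) \<longlonglongrightarrow> max 0 (min 1 (indicat_real A x))"
        unfolding k_def by (intro tendsto_intros lim elim)
      also have "max 0 (min 1 (indicat_real A x)) = indicat_real A x" by (simp add: indicator_def)
      finally show ?case by (intro tendsto_intros)
    qed
    show "AE x in M01. norm (h x * of_real (k n x)) \<le> norm (h x)" for n
      by (intro AE_I2) (auto simp: norm_mult k_def intro!: mult_right_le_one_le)
  qed
  moreover have "(LINT x|M01. h x * of_real (k n x)) = 0" for n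
    by (rule inner_continuous_zero[OF h z' kc])
  ultimately have "(LINT x|M01. h x * of_real (indicat_real A x)) = 0"
    by (simp add: LIMSEQ_const_iff)
  then show "set_lebesgue_integral M01 A h = 0"
    by (simp add: set_lebesgue_integral_def scaleR_conv_of_real mult.commute)
qed

lemma mellin_inject:
  assumes "f \<in> L2" "g \<in> L2" "\<And>u. Re u > 0 \<Longrightarrow> mellin f u = mellin g u"
  shows "ae_eq f g"
proof -
  have "mellin (\<lambda>x. f x - g x) u = 0" if "Re u > 0" for u
    using assms that unfolding mellin_def by (subst inner_diff_left) (auto intro: mon_L2)
  then have "AE x in M01. f x - g x = 0"
    by (intro mellin_zero_imp_ae_zero L2_diff assms)
  then show ?thesis by (simp add: ae_eq_def)
qed

subsection \<open>Dilations and multiplications\<close>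

text \<open>The change of variables is made on the open interval, since \<open>x powr a\<close> need
  not be differentiable at 0; the endpoints form a null set.\<close>

lemma integral_powr_substitution:
  fixes F :: "real \<Rightarrow> 'a::euclidean_space"
  assumes a: "a > 0" and F: "integrable M01 F"
  shows "integrable M01 (\<lambda>x. (a * x powr (a - 1)) *\<^sub>R F (x powr a))"
    and "(LINT x|M01. (a * x powr (a - 1)) *\<^sub>R F (x powr a)) = (LINT x|M01. F x)"
proof -
  let ?S = "{0<..<1::real}" and ?G = "\<lambda>x. \<bar>a * x powr (a - 1)\<bar> *\<^sub>R F (x powr a)"
  have open_closed: "h absolutely_integrable_on ?S \<longleftrightarrow> h absolutely_integrable_on {0..1}"
    for h :: "real \<Rightarrow> 'a"
    using absolutely_integrable_on_open_interval[of 0 1 h] by simp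
  have img: "(\<lambda>x. x powr a) ` ?S = ?S"
  proof
    show "(\<lambda>x. x powr a) ` ?S \<subseteq> ?S"
      using a powr_less_mono2[of a _ 1] by auto
    show "?S \<subseteq> (\<lambda>x. x powr a) ` ?S"
    proof
      fix y assume y: "y \<in> ?S"
      then have "(y powr (1/a)) powr a = y" using a by (simp add: powr_powr)
      moreover have "y powr (1/a) \<in> ?S" using y a powr_less_mono2[of "1/a" y 1] by auto
      ultimately show "y \<in> (\<lambda>x. x powr a) ` ?S" by (metis imageI)
    qed
  qed
  have "F absolutely_integrable_on ?S \<and> integral ?S F = integral ?S F"
    using F by (simp add: integrable_M01_iff open_closed)
  then have *: "?G absolutely_integrable_on ?S \<and> integral ?S ?G = integral ?S F"
  proof (subst has_absolute_integral_change_of_variables_real)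
    show "((\<lambda>x. x powr a) has_field_derivative a * x powr (a - 1)) (at x within ?S)" if "x \<in> ?S" for x
      using that by (auto intro!: derivative_eq_intros)
    show "inj_on (\<lambda>x. x powr a) ?S"
    proof (rule inj_onI)
      fix x y assume xy: "x \<in> ?S" "y \<in> ?S" "x powr a = y powr a"
      show "x = y"
        using powr_less_mono2[of a x y] powr_less_mono2[of a y x] xy a by force
    qed
  qed (auto simp: img)
  have G: "?G = (\<lambda>x. (a * x powr (a - 1)) *\<^sub>R F (x powr a))" using a by auto
  show int: "integrable M01 (\<lambda>x. (a * x powr (a - 1)) *\<^sub>R F (x powr a))"
    using * unfolding G integrable_M01_iff open_closed by blast
  show "(LINT x|M01. (a * x powr (a - 1)) *\<^sub>R F (x powr a)) = (LINT x|M01. F x)"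
    unfolding lint_M01[OF int] lint_M01[OF F] integral_open_interval_real using * unfolding G by blast
qed

text \<open>The weight has squared modulus \<open>a * x powr (a - 1)\<close>, the Jacobian of
  \<open>x powr a\<close>, so this is an isometry of \<open>L2\<close>. The imaginary exponent adds
  a multiplication by \<open>x^(ib)\<close>.\<close>

definition dilate :: "real \<Rightarrow> real \<Rightarrow> (real \<Rightarrow> complex) \<Rightarrow> real \<Rightarrow> complex" where
  "dilate a b f = (\<lambda>x. of_real (sqrt a) * mon (of_real ((a - 1) / 2) + \<i> * of_real b) x * f (x powr a))"

text \<open>As \<open>f\<close> is only Lebesgue measurable, measurability of its composition with
  \<open>x powr a\<close> is taken from the substituted integrand, whose weight is then
  exchanged.\<close>

lemma dilate_L2:
  assumes a: "a > 0" and f: "f \<in> L2"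
  shows "dilate a b f \<in> L2"
proof (rule L2_bound)
  let ?h = "\<lambda>x. (a * x powr (a - 1)) *\<^sub>R f (x powr a)"
  let ?k = "\<lambda>x. of_real (sqrt a) * mon (of_real ((a - 1) / 2) + \<i> * of_real b) x
      * of_real (inverse (a * x powr (a - 1)))"
  have "?h \<in> borel_measurable M01"
    by (intro borel_measurable_integrable integral_powr_substitution a L2_integrable f)
  moreover have "(\<lambda>x::real. complex_of_real (inverse (a * x powr (a - 1)))) \<in> borel_measurable M01"
    by (intro measurable_M01_borel) measurable
  ultimately have "(\<lambda>x. ?k x * ?h x) \<in> borel_measurable M01"
    by (intro borel_measurable_times) auto
  also have "?this \<longleftrightarrow> dilate a b f \<in> borel_measurable M01"
  proof (rule measurable_cong)
    fix x assume "x \<in> space M01"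
    then have "x \<ge> 0" by simp
    then show "?k x * ?h x = dilate a b f x"
      using a by (cases "x = 0") (simp_all add: dilate_def scaleR_conv_of_real field_simps)
  qed
  finally show "dilate a b f \<in> borel_measurable M01" .
  show "integrable M01 (\<lambda>x. (a * x powr (a - 1)) *\<^sub>R (cmod (f (x powr a)))\<^sup>2)"
    by (intro integral_powr_substitution(1)[of a "\<lambda>x. (cmod (f x))\<^sup>2"] a L2_integrable_sq f)
  show "AE x in M01. (cmod (dilate a b f x))\<^sup>2 \<le> (a * x powr (a - 1)) *\<^sub>R (cmod (f (x powr a)))\<^sup>2"
    using AE_M01_pos
  proof eventually_elim
    case (elim x)
    then show ?case using a
      by (simp add: dilate_def norm_mult norm_mon power_mult_distrib powr_power diff_divide_distrib)
  qed
qed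

lemma mon_powr: "x > 0 \<Longrightarrow> mon s (x powr a) = mon (of_real a * s) x"
  by (simp add: mon_exp ln_powr mult_ac)

text \<open>After the substitution \<open>y = x powr a\<close>, the parameter
  \<open>(u - ib) / a\<close> is the one that makes the exponents of \<open>x\<close> agree.\<close>

lemma mellin_dilate:
  assumes a: "a > 0" and f: "f \<in> L2" and u: "Re u > 0"
  shows "mellin (dilate a b f) u = of_real (1 / sqrt a) * mellin f ((u - \<i> * of_real b) / of_real a)"
proof -
  let ?v = "(u - \<i> * of_real b) / of_real a"
  let ?F = "\<lambda>y. f y * cnj (mon (?v - 1/2) y)"
  have v: "Re ?v > 0" using u a by (simp add: Re_divide_of_real)
  have F: "integrable M01 ?F" using v by (intro L2_mult_integrable f mon_L2) auto
  have "mellin (dilate a b f) u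
      = (LINT x|M01. of_real (1 / sqrt a) * ((a * x powr (a - 1)) *\<^sub>R ?F (x powr a)))"
    unfolding mellin_def l2_inner_def
  proof (rule integral_cong_AE)
    show "(\<lambda>x. dilate a b f x * cnj (mon (u - 1/2) x)) \<in> borel_measurable M01"
      using u by (intro borel_measurable_integrable L2_mult_integrable dilate_L2 a f mon_L2) auto
    show "(\<lambda>x. of_real (1 / sqrt a) * ((a * x powr (a - 1)) *\<^sub>R ?F (x powr a))) \<in> borel_measurable M01"
      using integral_powr_substitution(1)[OF a F]
      by (intro borel_measurable_times borel_measurable_integrable) auto
    show "AE x in M01. dilate a b f x * cnj (mon (u - 1/2) x)
        = of_real (1 / sqrt a) * ((a * x powr (a - 1)) *\<^sub>R ?F (x powr a))"
      using AE_M01_pos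
    proof eventually_elim
      case (elim x)
      have x: "x \<ge> 0" "x > 0" using elim by auto
      let ?q = "of_real (a / 2 - 1) + \<i> * of_real b + cnj u"
      have e1: "of_real ((a - 1) / 2) + \<i> * of_real b + cnj (u - 1/2) = ?q"
        by (simp add: complex_eq_iff field_simps)
      have "dilate a b f x * cnj (mon (u - 1/2) x)
          = of_real (sqrt a) * (mon (of_real ((a - 1) / 2) + \<i> * of_real b) x * mon (cnj (u - 1/2)) x) * f (x powr a)"
        unfolding dilate_def cnj_mon[OF x(1)] by (simp only: mult_ac)
      also have "\<dots> = of_real (sqrt a) * mon ?q x * f (x powr a)"
        unfolding mon_mult[OF x(1)] e1 ..
      finally have L: "dilate a b f x * cnj (mon (u - 1/2) x) = of_real (sqrt a) * mon ?q x * f (x powr a)" .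
      have pw: "of_real (x powr (a - 1)) = mon (of_real (a - 1)) x"
        using x(1) unfolding mon_def by (rule powr_of_real[symmetric])
      have e2: "of_real (a - 1) + of_real a * cnj (?v - 1/2) = ?q"
        using a by (simp add: field_simps)
      have "(a * x powr (a - 1)) *\<^sub>R ?F (x powr a)
          = of_real a * (mon (of_real (a - 1)) x * mon (of_real a * cnj (?v - 1/2)) x) * f (x powr a)"
        unfolding scaleR_conv_of_real of_real_mult pw mon_powr[OF x(2)] cnj_mon[OF x(1)]
          complex_cnj_mult complex_cnj_complex_of_real
        by (simp only: mult_ac)
      also have "\<dots> = of_real a * mon ?q x * f (x powr a)"
        unfolding mon_mult[OF x(1)] e2 ..
      finally have R: "(a * x powr (a - 1)) *\<^sub>R ?F (x powr a) = of_real a * mon ?q x * f (x powr a)" .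
      have "1 / sqrt a * a = sqrt a" using a by (simp add: real_div_sqrt)
      then have "complex_of_real (1 / sqrt a) * of_real a = of_real (sqrt a)"
        by (simp only: of_real_mult[symmetric])
      then show ?case unfolding L R by (simp only: mult.assoc[symmetric])
    qed
  qed
  also have "\<dots> = of_real (1 / sqrt a) * (LINT x|M01. ?F x)"
    unfolding integral_powr_substitution(2)[OF a F, symmetric] by (rule integral_mult_right_zero)
  finally show ?thesis by (simp only: mellin_def l2_inner_def)
qed

lemma L2_on_L2: "f \<in> L2_on r \<Longrightarrow> f \<in> L2"
  by (simp add: L2_on_def)

lemma L2_on_cong: "f \<in> L2_on r \<Longrightarrow> g \<in> L2 \<Longrightarrow> ae_eq f g \<Longrightarrow> g \<in> L2_on r"
  unfolding L2_on_def ae_eq_def by auto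

lemma L2_on_scale: "f \<in> L2_on r \<Longrightarrow> (\<lambda>x. c * f x) \<in> L2_on r"
  unfolding L2_on_def by (auto intro: L2_scale)

text \<open>Since \<open>f\<close> vanishes only almost everywhere on \<open>[0,r]\<close>, this is
  carried over through an integral: the modulus of \<open>f\<close> there has integral zero, and so
  has its substituted form.\<close>

lemma dilate_L2_on:
  assumes a: "a > 0" and r: "r > 0" and f: "f \<in> L2_on r"
  shows "dilate a b f \<in> L2_on (r powr (1 / a))"
proof -
  note fL = L2_on_L2[OF f]
  let ?F = "\<lambda>y. cmod (f y) * indicat_real {..r} y"
  have ae: "AE y in M01. ?F y = 0"
    using f unfolding L2_on_def by (auto simp: indicator_def)
  have meas: "?F \<in> borel_measurable M01"
    using L2_measurable[OF fL]
    by (intro borel_measurable_times borel_measurable_norm measurable_M01_borel[of "indicat_real _"]) auto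
  have F: "integrable M01 ?F"
    using ae meas by (subst integrable_cong_AE[where g = "\<lambda>_. 0"]) auto
  have "(LINT x|M01. ?F x) = 0" using ae by (rule integral_eq_zero_AE)
  then have "(LINT x|M01. (a * x powr (a - 1)) *\<^sub>R ?F (x powr a)) = 0"
    using integral_powr_substitution(2)[OF a F] by simp
  then have "AE x in M01. (a * x powr (a - 1)) *\<^sub>R ?F (x powr a) = 0"
    using a by (subst (asm) integral_nonneg_eq_0_iff_AE[OF integral_powr_substitution(1)[OF a F]])
      (auto intro!: AE_I2 mult_nonneg_nonneg)
  then have "AE x in M01. x \<le> r powr (1 / a) \<longrightarrow> dilate a b f x = 0"
    using AE_M01_pos
  proof eventually_elim
    case (elim x)
    show ?case
    proof
      assume "x \<le> r powr (1 / a)"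
      then have "x powr a \<le> (r powr (1 / a)) powr a" using elim a by (intro powr_mono2) auto
      then have "x powr a \<le> r" using a r by (simp add: powr_powr)
      then show "dilate a b f x = 0" using elim a by (auto simp: dilate_def)
    qed
  qed
  then show ?thesis using dilate_L2[OF a fL] by (simp add: L2_on_def)
qed

section \<open>Multiplication by imaginary powers and the operator J\<close>

lemma mult_L2:
  assumes f: "f \<in> L2"
  shows "(\<lambda>x. mon (\<i> * of_real b) x * f x) \<in> L2"
proof (rule L2_bound)
  show "(\<lambda>x. mon (\<i> * of_real b) x * f x) \<in> borel_measurable M01"
    using L2_measurable[OF f] by measurable
  show "integrable M01 (\<lambda>x. (cmod (f x))\<^sup>2)" by (rule L2_integrable_sq[OF f])
  show "AE x in M01. (cmod (mon (\<i> * of_real b) x * f x))\<^sup>2 \<le> (cmod (f x))\<^sup>2"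
    using AE_M01_pos by eventually_elim (simp add: norm_mult norm_mon)
qed

lemma mellin_mult:
  "mellin (\<lambda>x. mon (\<i> * of_real b) x * f x) u = mellin f (u - \<i> * of_real b)"
  unfolding mellin_def l2_inner_def
proof (intro Bochner_Integration.integral_cong refl)
  fix x assume "x \<in> space M01"
  then have x: "x \<ge> 0" by simp
  have "mon (\<i> * of_real b) x * cnj (mon (u - 1/2) x) = cnj (mon (u - \<i> * of_real b - 1/2) x)"
    unfolding cnj_mon[OF x] mon_mult[OF x] by (simp add: algebra_simps)
  then show "mon (\<i> * of_real b) x * f x * cnj (mon (u - 1/2) x)
      = f x * cnj (mon (u - \<i> * of_real b - 1/2) x)"
    by (simp only: mult.commute[of "mon _ _" "f x"] mult.assoc)
qed

text \<open>The transform side of \<open>g = x\<^bsup>ic\<^esup> J f\<close>.\<close>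

definition J_twist :: "real \<Rightarrow> (real \<Rightarrow> complex) \<Rightarrow> (real \<Rightarrow> complex) \<Rightarrow> bool" where
  "J_twist c f g \<longleftrightarrow> (\<forall>u. Re u > 0 \<longrightarrow> mellin g u
     = cnj (1 / (2 * (u - \<i> * of_real c))) * mellin f (1 / (4 * (u - \<i> * of_real c))))"

text \<open>The coefficient description of \<open>J\<close> becomes the transform identity
  \<open>J_twist\<close>, by \<open>J_mellin_iff\<close> and a shift of the parameter by
  \<open>ic\<close>.\<close>

lemma mem_mult_J_image_iff:
  assumes A: "A \<subseteq> L2"
  shows "g \<in> mult_image c (J_image A) \<longleftrightarrow> g \<in> L2 \<and> (\<exists>f\<in>A. J_twist c f g)"
proof safe
  assume "g \<in> mult_image c (J_image A)"
  then obtain k f where g: "g \<in> L2" and k: "k \<in> L2" and f: "f \<in> A"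
    and J: "\<forall>n. l2_inner k (e_basis n) = (-1) ^ n * l2_inner f (e_basis n)"
    and gk: "ae_eq g (\<lambda>x. mon (\<i> * of_real c) x * k x)"
    unfolding mult_image_def J_image_def by blast
  show "g \<in> L2" by fact
  have "J_twist c f g"
    unfolding J_twist_def
  proof (intro allI impI)
    fix u assume u: "Re u > 0"
    have "mellin g u = mellin (\<lambda>x. mon (\<i> * of_real c) x * k x) u"
      by (intro mellin_cong g mult_L2 k gk u)
    also have "\<dots> = mellin k (u - \<i> * of_real c)" by (rule mellin_mult)
    also have "\<dots> = cnj (1 / (2 * (u - \<i> * of_real c))) * mellin f (1 / (4 * (u - \<i> * of_real c)))"
      using J_mellin_iff[of f k] J f A k u by auto
    finally show "mellin g u = cnj (1 / (2 * (u - \<i> * of_real c))) * mellin f (1 / (4 * (u - \<i> * of_real c)))" .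
  qed
  with f show "\<exists>f\<in>A. J_twist c f g" by blast
next
  fix f assume g: "g \<in> L2" and f: "f \<in> A" and J: "J_twist c f g"
  \<comment> \<open>Multiplication by the opposite power recovers the required element of the image
    of \<open>J\<close>.\<close>
  define k where "k = (\<lambda>x. mon (\<i> * of_real (- c)) x * g x)"
  have k: "k \<in> L2" unfolding k_def by (intro mult_L2 g)
  have "mellin k u = cnj (1 / (2 * u)) * mellin f (1 / (4 * u))" if "Re u > 0" for u
  proof -
    have "mellin k u = mellin g (u + \<i> * of_real c)" unfolding k_def mellin_mult by simp
    also have "\<dots> = cnj (1 / (2 * u)) * mellin f (1 / (4 * u))"
      using J that unfolding J_twist_def by (auto dest!: spec[of _ "u + \<i> * of_real c"])
    finally show ?thesis .
  qed
  then have "\<forall>n. l2_inner k (e_basis n) = (-1) ^ n * l2_inner f (e_basis n)"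
    using J_mellin_iff[of f k] k f A by auto
  then have "k \<in> J_image A" using k f by (auto simp: J_image_def)
  moreover have "ae_eq g (\<lambda>x. mon (\<i> * of_real c) x * k x)"
    unfolding ae_eq_def using AE_M01_pos
    by eventually_elim (simp add: k_def mon_exp exp_minus)
  ultimately show "g \<in> mult_image c (J_image A)" using g by (auto simp: mult_image_def)
qed

lemma L2_on_subset: "L2_on r \<subseteq> L2"
  by (auto simp: L2_on_def)

text \<open>The argument \<open>ic + 1 / (4v)\<close> solves \<open>v = 1 / (4 * (u - ic))\<close>
  for \<open>u\<close>. Large \<open>v\<close> thus probe the transform of \<open>g\<close> near the
  boundary point \<open>ic\<close>.\<close>

lemma J_twist_inverse:
  assumes "J_twist c f g" "Re v > 0"
  shows "mellin g (\<i> * of_real c + 1 / (4 * v)) = cnj (2 * v) * mellin f v"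
proof -
  have "v \<noteq> 0" using assms by auto
  moreover have "Re (\<i> * of_real c + 1 / (4 * v)) > 0"
    using assms by (simp add: Re_divide add_pos_nonneg)
  ultimately show ?thesis using assms(1) unfolding J_twist_def
    by (auto dest!: spec[of _ "\<i> * of_real c + 1 / (4 * v)"])
qed

lemma J_twist_inject:
  assumes f: "f \<in> L2" "f' \<in> L2" and J: "J_twist c f g" "J_twist c f' g"
  shows "ae_eq f f'"
proof (rule mellin_inject[OF f])
  fix v :: complex assume v: "Re v > 0"
  then have "cnj (2 * v) \<noteq> 0" by auto
  moreover have "cnj (2 * v) * mellin f v = cnj (2 * v) * mellin f' v"
    unfolding J_twist_inverse[OF J(1) v, symmetric] J_twist_inverse[OF J(2) v, symmetric] ..
  ultimately show "mellin f v = mellin f' v" by (simp only: mult_cancel_left simp_thms)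
qed

subsection \<open>Boundary behaviour\<close>

text \<open>Dominated convergence: the support avoids a neighbourhood of 0, so the kernel stays
  bounded for bounded parameters. The limit \<open>p\<close> may be any complex number, in
  particular a boundary point.\<close>

lemma mellin_L2_on_tendsto:
  assumes r: "0 < r" and f: "f \<in> L2_on r" and u: "u \<longlonglongrightarrow> p"
  shows "(\<lambda>k. mellin f (u k)) \<longlonglongrightarrow> mellin f p"
proof -
  note fL = L2_on_L2[OF f]
  have "Bseq u" using u by (intro convergent_imp_Bseq convergentI)
  then obtain B where B: "\<And>k. norm (u k) \<le> B" by (auto simp: Bseq_def)
  \<comment> \<open>\<open>R\<close> bounds the modulus of the kernel on \<open>r < x < 1\<close>
    for all real parts between \<open>-B\<close> and \<open>B\<close>.\<close>
  define R where "R = (min r 1) powr (- B - 1/2)"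
  show ?thesis
    unfolding mellin_def l2_inner_def
  proof (rule integral_dominated_convergence)
    show "(\<lambda>x. f x * cnj (mon (p - 1/2) x)) \<in> borel_measurable M01"
      "(\<lambda>x. f x * cnj (mon (u k - 1/2) x)) \<in> borel_measurable M01" for k
      using L2_measurable[OF fL] by measurable
    show "integrable M01 (\<lambda>x. norm (f x) * R)" using L2_integrable[OF fL] by simp
    show "AE x in M01. (\<lambda>k. f x * cnj (mon (u k - 1/2) x)) \<longlonglongrightarrow> f x * cnj (mon (p - 1/2) x)"
      using AE_M01_pos
    proof eventually_elim
      case (elim x)
      then show ?case using u by (simp add: mon_exp tendsto_intros)
    qed
    show "AE x in M01. norm (f x * cnj (mon (u k - 1/2) x)) \<le> norm (f x) * R" for k
    proof -
      have "AE x in M01. x \<le> r \<longrightarrow> f x = 0" using f by (simp add: L2_on_def)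
      then show ?thesis using AE_M01_pos
      proof eventually_elim
        case (elim x)
        show ?case
        proof (cases "x \<le> r")
          case True
          then show ?thesis using elim by simp
        next
          case False
          have "\<bar>Re (u k)\<bar> \<le> B" using abs_Re_le_cmod[of "u k"] B[of k] by linarith
          then have "x powr (Re (u k) - 1/2) \<le> x powr (- B - 1/2)"
            using elim by (intro powr_mono') auto
          also have "\<dots> \<le> R" unfolding R_def
            using elim False r order_trans[OF norm_ge_zero B[of k]] by (intro powr_mono2') auto
          finally show ?thesis using elim
            by (simp add: norm_mult norm_mon mult_left_mono)
        qed
      qed
    qed
  qed
qed

text \<open>A test element of \<open>L2_on r\<close> with an elementary transform, used to detect
  the boundary singularity.\<close>

definition step_fun :: "real \<Rightarrow> real \<Rightarrow> complex" where
  "step_fun r = (\<lambda>x. if r < x then 1 else 0)"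

lemma step_fun_L2_on: "step_fun r \<in> L2_on r"
proof -
  have "step_fun r \<in> L2"
  proof (rule L2_bound)
    show "step_fun r \<in> borel_measurable M01"
      unfolding step_fun_def by (intro measurable_M01_borel) measurable
    show "integrable M01 (\<lambda>x. (cmod 1)\<^sup>2)" by (rule L2_integrable_sq[OF L2_const])
  qed (auto simp: step_fun_def)
  then show ?thesis by (simp add: L2_on_def step_fun_def)
qed

lemma mellin_step_fun:
  assumes r: "0 < r" "r < 1" and u: "Re u > 0"
  shows "mellin (step_fun r) u = (1 - mon (cnj u + 1/2) r) / (cnj u + 1/2)"
proof -
  have u0: "cnj u + 1/2 \<noteq> 0" using u by (auto simp: complex_eq_iff)
  let ?F = "\<lambda>x. step_fun r x * cnj (mon (u - 1/2) x)"
  have "integrable M01 ?F"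
    using u by (intro L2_mult_integrable L2_on_L2[OF step_fun_L2_on] mon_L2) auto
  then have "mellin (step_fun r) u = integral {0..1} ?F"
    unfolding mellin_def l2_inner_def by (rule lint_M01)
  also have "\<dots> = integral {0..1} (\<lambda>x. if x \<in> {r..1} then mon (cnj u - 1/2) x else 0)"
  proof (rule integral_spike[of "{r}"])
    fix x assume "x \<in> {0..1} - {r}"
    then show "(if x \<in> {r..1} then mon (cnj u - 1/2) x else 0) = ?F x"
      by (auto simp: step_fun_def cnj_mon)
  qed simp
  also have "\<dots> = integral {r..1} (mon (cnj u - 1/2))"
    using r by (subst integral_restrict_Int) (simp add: Int_absorb2)
  also have "\<dots> = (mon (cnj u + 1/2) 1 - mon (cnj u + 1/2) r) / (cnj u + 1/2)"
  proof -
    have "((\<lambda>x. (cnj u + 1/2) * mon (cnj u - 1/2) x) has_integral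
        (mon (cnj u + 1/2) 1 - mon (cnj u + 1/2) r)) {r..1}"
    proof (rule fundamental_theorem_of_calculus)
      fix x assume "x \<in> {r..1}"
      then have "x > 0" using r by auto
      have "cnj u - 1/2 + 1 = cnj u + 1/2" by simp
      from mon_ln_power_vector_derivative[OF \<open>x > 0\<close>, of "cnj u - 1/2" 0, unfolded this]
      show "(mon (cnj u + 1/2) has_vector_derivative (cnj u + 1/2) * mon (cnj u - 1/2) x) (at x within {r..1})"
        by (simp add: has_vector_derivative_at_within)
    qed (use r in auto)
    then have "((\<lambda>x. (1 / (cnj u + 1/2)) * ((cnj u + 1/2) * mon (cnj u - 1/2) x)) has_integral
        (1 / (cnj u + 1/2)) * (mon (cnj u + 1/2) 1 - mon (cnj u + 1/2) r)) {r..1}"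
      by (rule has_integral_mult_right)
    then show ?thesis using u0 by (intro integral_unique) simp
  qed
  finally show ?thesis by (simp add: mon_def)
qed

text \<open>On the line \<open>Re v = 1\<close> the power of \<open>r\<close> in
  \<open>mellin_step_fun\<close> has constant modulus and rotates without a limit. The weight
  \<open>cnj (2 * v)\<close> is the one in \<open>J_twist_inverse\<close>.\<close>

lemma mellin_step_fun_oscillates:
  assumes r: "0 < r" "r < 1"
  obtains v :: "nat \<Rightarrow> complex" where "\<And>k. Re (v k) > 0" "filterlim v at_infinity sequentially"
    "\<not> convergent (\<lambda>k. cnj (2 * v k) * mellin (step_fun r) (v k))"
proof
  \<comment> \<open>These heights rotate the power by half turns, so that it becomes
    \<open>q * (-1) ^ k\<close> with \<open>q = r powr (3/2)\<close>.\<close>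
  define y where "y = (\<lambda>k::nat. pi * real k / ln r)"
  define v where "v = (\<lambda>k. 1 + \<i> * of_real (y k))"
  have lr: "ln r < 0" using r by simp
  show re: "Re (v k) > 0" for k by (simp add: v_def)
  have "filterlim (\<lambda>k. norm (v k)) at_top sequentially"
  proof (rule filterlim_at_top_mono)
    show "filterlim (\<lambda>k. pi / \<bar>ln r\<bar> * real k) at_top sequentially"
      using lr by (intro filterlim_tendsto_pos_mult_at_top[OF tendsto_const] filterlim_real_sequentially)
        (auto simp: divide_pos_neg)
    have "pi / \<bar>ln r\<bar> * real k \<le> norm (v k)" for k
      using abs_Im_le_cmod[of "v k"] lr by (simp add: v_def y_def abs_mult abs_divide)
    then show "\<forall>\<^sub>F k in sequentially. pi / \<bar>ln r\<bar> * real k \<le> norm (v k)" by simp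
  qed
  then show inf: "filterlim v at_infinity sequentially"
    by (rule filterlim_norm_at_top_imp_at_infinity)
  define q where "q = complex_of_real (r powr (3/2))"
  have q: "q \<noteq> 0" using r by (simp add: q_def)
  have osc: "mon (cnj (v k) + 1/2) r = q * (-1) ^ k" for k
  proof -
    have "(cnj (v k) + 1/2) * of_real (ln r) = of_real (3/2 * ln r) + - (of_nat k * (\<i> * of_real pi))"
      using lr by (simp add: v_def y_def complex_eq_iff)
    then have "mon (cnj (v k) + 1/2) r = exp (of_real (3/2 * ln r)) * inverse (exp (\<i> * of_real pi) ^ k)"
      using r by (simp only: mon_exp exp_add exp_minus exp_of_nat_mult)
    also have "exp (of_real (3/2 * ln r)) = q"
      using r by (simp only: q_def powr_def exp_of_real) simp
    also have "inverse (exp (\<i> * of_real pi) ^ k) = (-1) ^ k"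
      by (simp add: exp_pi_i power_inverse[symmetric])
    finally show ?thesis .
  qed
  \<comment> \<open>This factor tends to 2, so convergence of the product would force convergence of
    \<open>1 - q * (-1) ^ k\<close>.\<close>
  define m where "m = (\<lambda>k. cnj (2 * v k) / (cnj (v k) + 1/2))"
  have eq: "cnj (2 * v k) * mellin (step_fun r) (v k) = m k * (1 - q * (-1) ^ k)" for k
    unfolding mellin_step_fun[OF r re] osc m_def by simp
  have m: "m \<longlonglongrightarrow> 2"
  proof -
    have "filterlim (\<lambda>k. cnj (v k)) at_infinity sequentially"
      using inf unfolding filterlim_at_infinity_conv_norm_at_top by simp
    then have "filterlim (\<lambda>k. cnj (v k) + 1/2) at_infinity sequentially"
      using tendsto_add_filterlim_at_infinity'[OF _ tendsto_const] by blast
    then have "(\<lambda>k. 1 / (cnj (v k) + 1/2)) \<longlonglongrightarrow> 0"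
      by (intro tendsto_divide_0[OF tendsto_const])
    then have "(\<lambda>k. 2 - 1 / (cnj (v k) + 1/2)) \<longlonglongrightarrow> 2 - 0"
      by (intro tendsto_diff tendsto_const)
    moreover have "2 - 1 / (cnj (v k) + 1/2) = m k" for k
    proof -
      have "cnj (v k) + 1/2 \<noteq> 0" by (simp add: v_def complex_eq_iff)
      then show ?thesis unfolding m_def by (simp add: divide_simps)
    qed
    ultimately show ?thesis by simp
  qed
  show "\<not> convergent (\<lambda>k. cnj (2 * v k) * mellin (step_fun r) (v k))"
  proof
    assume "convergent (\<lambda>k. cnj (2 * v k) * mellin (step_fun r) (v k))"
    then obtain l where "(\<lambda>k. m k * (1 - q * (-1) ^ k)) \<longlonglongrightarrow> l"
      unfolding eq by (auto simp: convergent_def)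
    then have "(\<lambda>k. m k * (1 - q * (-1) ^ k) / m k) \<longlonglongrightarrow> l / 2"
      using m by (intro tendsto_divide) auto
    moreover have "m k \<noteq> 0" for k
    proof -
      have "cnj (2 * v k) \<noteq> 0" "cnj (v k) + 1/2 \<noteq> 0" by (simp_all add: v_def complex_eq_iff)
      then show ?thesis by (simp only: m_def divide_eq_0_iff simp_thms)
    qed
    ultimately have lim: "(\<lambda>k. 1 - q * (-1) ^ k) \<longlonglongrightarrow> l / 2" by simp
    \<comment> \<open>Even and odd indices give the limits \<open>1 - q\<close> and
      \<open>1 + q\<close>, which differ since \<open>q\<close> is nonzero.\<close>
    have "(\<lambda>k. 1 - q * (-1) ^ (2 * k)) \<longlonglongrightarrow> l / 2"
      using LIMSEQ_subseq_LIMSEQ[OF lim, of "\<lambda>k. 2 * k"] by (simp add: o_def strict_mono_def)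
    moreover have "(\<lambda>k. 1 - q * (-1) ^ (2 * k + 1)) \<longlonglongrightarrow> l / 2"
      using LIMSEQ_subseq_LIMSEQ[OF lim, of "\<lambda>k. 2 * k + 1"] by (simp add: o_def strict_mono_def)
    ultimately have h: "1 - q = l / 2" "1 + q = l / 2" by (simp_all add: LIMSEQ_const_iff)
    have "(1 + q) - (1 - q) = 0" unfolding h by simp
    with q show False by simp
  qed
qed

section \<open>Distinguishing the model spaces\<close>

text \<open>For the smaller endpoint the step function lies in the space, but it is 1 between the
  two endpoints, on a set of positive measure.\<close>

lemma L2_on_inject:
  assumes "L2_on r = L2_on r'" "0 < r" "r < 1" "0 < r'" "r' < 1"
  shows "r = r'"
proof -
  have False if eq: "L2_on r = L2_on r'" and r: "0 < r" "r' < 1" "r < r'" for r r' :: real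
  proof -
    have "step_fun r \<in> L2_on r'" using step_fun_L2_on eq by blast
    then have "AE x in M01. x \<le> r' \<longrightarrow> step_fun r x = 0" by (simp add: L2_on_def)
    then have "AE x in lebesgue. x \<in> {0..1} \<longrightarrow> x \<le> r' \<longrightarrow> step_fun r x = 0"
      by (subst (asm) AE_restrict_space_iff) auto
    then have "AE x in lebesgue. x \<notin> {r<..r'}"
      by eventually_elim (use r in \<open>auto simp: step_fun_def split: if_splits\<close>)
    then have "{r<..r'} \<in> null_sets lebesgue" by (subst AE_iff_null_sets) auto
    then have "emeasure lebesgue {r<..r'} = 0" by auto
    then show False using r by simp
  qed
  from this[of r r'] this[of r' r] show ?thesis using assms by (cases r r' rule: linorder_cases) auto
qed

text \<open>The weighted transform of a step function oscillates at infinity. For an element of the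
  twisted space it would converge: \<open>1 / (4 * (v - ic))\<close> tends to 0, and the transform
  of \<open>f\<close> is continuous at 0.\<close>

lemma L2_on_neq_mult_J_image:
  assumes r: "0 < r" "r < 1" and r': "0 < r'"
  shows "L2_on r \<noteq> mult_image c (J_image (L2_on r'))"
proof
  assume "L2_on r = mult_image c (J_image (L2_on r'))"
  then have "step_fun r \<in> mult_image c (J_image (L2_on r'))" using step_fun_L2_on by blast
  then obtain f where f: "f \<in> L2_on r'" and J: "J_twist c f (step_fun r)"
    using mem_mult_J_image_iff[OF L2_on_subset] by blast
  obtain v where v: "\<And>k::nat. Re (v k) > 0" "filterlim v at_infinity sequentially"
    "\<not> convergent (\<lambda>k. cnj (2 * v k) * mellin (step_fun r) (v k))"
    using mellin_step_fun_oscillates[OF r] by metis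
  let ?w = "\<lambda>k. v k - \<i> * of_real c"
  have w0: "?w k \<noteq> 0" for k using v(1)[of k] by (auto simp: complex_eq_iff)
  have "filterlim ?w at_infinity sequentially"
    using tendsto_add_filterlim_at_infinity'[OF v(2) tendsto_const[of "- (\<i> * of_real c)"]] by simp
  then have inv0: "(\<lambda>k. 1 / ?w k) \<longlonglongrightarrow> 0" by (intro tendsto_divide_0[OF tendsto_const])
  have "(\<lambda>k. 1 / 4 * (1 / ?w k)) \<longlonglongrightarrow> 1 / 4 * 0" by (intro tendsto_intros inv0)
  then have lim1: "(\<lambda>k. 1 / (4 * ?w k)) \<longlonglongrightarrow> 0" by simp
  have "(\<lambda>k. cnj (1 + \<i> * of_real c * (1 / ?w k)) * mellin f (1 / (4 * ?w k)))
      \<longlonglongrightarrow> cnj (1 + \<i> * of_real c * 0) * mellin f 0"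
    by (intro tendsto_intros inv0 mellin_L2_on_tendsto[OF r' f lim1])
  \<comment> \<open>Up to conjugation, the weight times the prefactor of \<open>J_twist\<close> is
    \<open>v / (v - ic) = 1 + ic / (v - ic)\<close>, which tends to 1.\<close>
  moreover have "cnj (1 + \<i> * of_real c * (1 / ?w k)) * mellin f (1 / (4 * ?w k))
      = cnj (2 * v k) * mellin (step_fun r) (v k)" for k
  proof -
    have "1 + \<i> * of_real c * (1 / ?w k) = 2 * v k * (1 / (2 * ?w k))"
      using w0[of k] by (simp add: field_simps)
    then show ?thesis using J v(1)[of k] unfolding J_twist_def
      by (simp only: complex_cnj_mult mult.assoc)
  qed
  ultimately have "convergent (\<lambda>k. cnj (2 * v k) * mellin (step_fun r) (v k))"
    by (auto intro: convergentI)
  with v(3) show False by blast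
qed

text \<open>The image of the step function oscillates at \<open>ic\<close>, where transforms of
  elements with parameter \<open>c'\<close> have limits if \<open>c'\<close> differs from
  \<open>c\<close>. Equal twists cancel, and \<open>L2_on_inject\<close> applies. The hypothesis
  \<open>total\<close>, that the twist is defined on all of \<open>L2\<close>, is supplied by
  \<open>inversion_op_image\<close>.\<close>

lemma mult_J_image_inject:
  assumes total: "\<And>f. f \<in> L2 \<Longrightarrow> \<exists>g\<in>L2. J_twist c f g"
    and eq: "mult_image c (J_image (L2_on r)) = mult_image c' (J_image (L2_on r'))"
    and r: "0 < r" "r < 1" and r': "0 < r'" "r' < 1"
  shows "c = c'" "r = r'"
proof -
  obtain g where g: "g \<in> L2" "J_twist c (step_fun r) g"
    using total[OF L2_on_L2[OF step_fun_L2_on]] by blast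
  then have "g \<in> mult_image c' (J_image (L2_on r'))"
    using mem_mult_J_image_iff[OF L2_on_subset] step_fun_L2_on eq by blast
  then obtain f where f: "f \<in> L2_on r'" and J: "J_twist c' f g"
    using mem_mult_J_image_iff[OF L2_on_subset] by blast
  show cc: "c = c'"
  proof (rule ccontr)
    assume "c \<noteq> c'"
    obtain v where v: "\<And>k::nat. Re (v k) > 0" "filterlim v at_infinity sequentially"
      "\<not> convergent (\<lambda>k. cnj (2 * v k) * mellin (step_fun r) (v k))"
      using mellin_step_fun_oscillates[OF r] by metis
    \<comment> \<open>The inversion about \<open>ic\<close> sends these points to
      \<open>v k\<close>, so they approach \<open>ic\<close> as \<open>v\<close> goes to
      infinity.\<close>
    define u where "u = (\<lambda>k. \<i> * of_real c + 1 / (4 * v k))"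
    have upos: "Re (u k) > 0" for k
      using v(1)[of k] by (simp add: u_def Re_divide add_pos_nonneg)
    have "(\<lambda>k. 1 / v k) \<longlonglongrightarrow> 0" by (intro tendsto_divide_0[OF tendsto_const] v)
    then have "(\<lambda>k. \<i> * of_real c + 1 / 4 * (1 / v k)) \<longlonglongrightarrow> \<i> * of_real c + 1 / 4 * 0"
      by (intro tendsto_intros)
    then have "u \<longlonglongrightarrow> \<i> * of_real c" by (simp add: u_def)
    then have w: "(\<lambda>k. u k - \<i> * of_real c') \<longlonglongrightarrow> \<i> * of_real c - \<i> * of_real c'"
      by (intro tendsto_intros)
    have nz: "\<i> * of_real c - \<i> * of_real c' \<noteq> 0" using \<open>c \<noteq> c'\<close> by (simp add: complex_eq_iff)
    have lim1: "(\<lambda>k. 1 / (4 * (u k - \<i> * of_real c'))) \<longlonglongrightarrow> 1 / (4 * (\<i> * of_real c - \<i> * of_real c'))"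
      using nz by (intro tendsto_intros w) auto
    have "(\<lambda>k. cnj (1 / (2 * (u k - \<i> * of_real c'))) * mellin f (1 / (4 * (u k - \<i> * of_real c'))))
        \<longlonglongrightarrow> cnj (1 / (2 * (\<i> * of_real c - \<i> * of_real c'))) * mellin f (1 / (4 * (\<i> * of_real c - \<i> * of_real c')))"
      using nz by (intro tendsto_intros w mellin_L2_on_tendsto[OF r'(1) f lim1]) auto
    moreover have "cnj (1 / (2 * (u k - \<i> * of_real c'))) * mellin f (1 / (4 * (u k - \<i> * of_real c')))
        = cnj (2 * v k) * mellin (step_fun r) (v k)" for k
      using J upos[of k] J_twist_inverse[OF g(2) v(1)[of k]] unfolding J_twist_def u_def by metis
    ultimately have "convergent (\<lambda>k. cnj (2 * v k) * mellin (step_fun r) (v k))"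
      unfolding convergent_def by auto
    with v(3) show False by blast
  qed
  \<comment> \<open>The twist is total and injective up to null sets, so an inclusion of images
    gives one of the original spaces.\<close>
  have sub: "L2_on s \<subseteq> L2_on s'"
    if "mult_image c (J_image (L2_on s)) \<subseteq> mult_image c (J_image (L2_on s'))" for s s'
  proof
    fix f assume f: "f \<in> L2_on s"
    obtain g where g: "g \<in> L2" "J_twist c f g" using total[OF L2_on_L2[OF f]] by blast
    then have "g \<in> mult_image c (J_image (L2_on s'))"
      using mem_mult_J_image_iff[OF L2_on_subset] f that by blast
    then obtain f' where f': "f' \<in> L2_on s'" "J_twist c f' g"
      using mem_mult_J_image_iff[OF L2_on_subset] by blast
    then have "ae_eq f' f" using J_twist_inject[OF L2_on_L2 L2_on_L2] f g by blast
    then show "f \<in> L2_on s'" using L2_on_cong[OF f'(1) L2_on_L2[OF f]] by blast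
  qed
  show "r = r'"
    using sub[of r r'] sub[of r' r] eq cc r r' by (intro L2_on_inject) auto
qed

subsection \<open>Unitary monomial operators\<close>

text \<open>All three follow from \<open>l * cnj l = 1\<close>. The last one says that the quotient
  inside \<open>c_of\<close> is real, so taking its real part loses nothing.\<close>

lemma unit_circle_identities:
  assumes "cmod l = 1" "l \<noteq> 1"
  shows "Re (1 / (1 - l)) = 1 / 2"
    and "- l / (1 - l)\<^sup>2 = of_real (1 / (cmod (1 - l))\<^sup>2)"
    and "2 * \<i> * of_real (c_of l) = (l + 1) / (l - 1)"
proof -
  have ll: "l * cnj l = 1" using assms complex_norm_square[of l] by simp
  have n: "1 - l \<noteq> 0" "1 - cnj l \<noteq> 0" "l - 1 \<noteq> 0" "cnj l - 1 \<noteq> 0"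
    using assms by (auto simp: complex_cnj_one_iff)
  show "Re (1 / (1 - l)) = 1 / 2"
  proof -
    have "1 / (1 - l) + cnj (1 / (1 - l)) = ((1 - cnj l) + (1 - l)) / ((1 - l) * (1 - cnj l))"
      using n by (simp add: add_frac_eq)
    also have "(1 - l) * (1 - cnj l) = (1 - cnj l) + (1 - l)"
      using ll by (simp add: algebra_simps)
    also have "((1 - cnj l) + (1 - l)) / \<dots> = 1"
      using n unfolding \<open>(1 - l) * (1 - cnj l) = (1 - cnj l) + (1 - l)\<close>[symmetric] by simp
    finally show ?thesis unfolding complex_add_cnj of_real_eq_1_iff by simp
  qed
  have "- l * ((1 - l) * (1 - cnj l)) = (1 - l)\<^sup>2"
    using ll by (simp add: power2_eq_square algebra_simps)
  then have "- l / (1 - l)\<^sup>2 = 1 / ((1 - l) * (1 - cnj l))"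
    using n by (simp add: divide_simps)
  also have "(1 - l) * (1 - cnj l) = of_real ((cmod (1 - l))\<^sup>2)"
    by (subst complex_norm_square) simp
  finally show "- l / (1 - l)\<^sup>2 = of_real (1 / (cmod (1 - l))\<^sup>2)" by simp
  let ?z = "(l + 1) / (2 * \<i> * (l - 1))"
  have "(cnj l + 1) * (l - 1) = - (l + 1) * (cnj l - 1)"
    using ll by (simp add: algebra_simps)
  then have "cnj ?z = ?z" using n by (simp add: divide_simps)
  then have "?z \<in> \<real>" by (simp only: Reals_cnj_iff)
  then have "of_real (c_of l) = ?z" by (simp add: c_of_def)
  then show "2 * \<i> * of_real (c_of l) = (l + 1) / (l - 1)"
    using n by (simp add: field_simps)
qed

lemma c_of_inject:
  assumes "cmod s = 1" "s \<noteq> 1" "cmod t = 1" "t \<noteq> 1" "c_of s = c_of t"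
  shows "s = t"
proof -
  have "(s + 1) / (s - 1) = (t + 1) / (t - 1)"
    using unit_circle_identities(3)[OF assms(1,2)] unit_circle_identities(3)[OF assms(3,4)] assms(5) by simp
  then have "(s + 1) * (t - 1) = (t + 1) * (s - 1)" using assms by (simp add: frac_eq_eq)
  then show ?thesis by (simp add: algebra_simps)
qed

lemma c_of_surj:
  obtains t where "cmod t = 1" "t \<noteq> 1" "c_of t = b"
proof
  \<comment> \<open>This solves \<open>(t + 1) / (t - 1) = 2ib\<close> for \<open>t\<close>;
    numerator and denominator have equal modulus.\<close>
  define t where "t = (2 * \<i> * of_real b + 1) / (2 * \<i> * of_real b - 1)"
  have n: "2 * \<i> * of_real b - 1 \<noteq> 0" by (simp add: complex_eq_iff)
  have "cmod (2 * \<i> * of_real b + 1) = cmod (2 * \<i> * of_real b - 1)"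
    by (simp add: cmod_def)
  then show t: "cmod t = 1" using n by (simp add: t_def norm_divide)
  have t1: "t - 1 = 2 / (2 * \<i> * of_real b - 1)" "t + 1 = 4 * \<i> * of_real b / (2 * \<i> * of_real b - 1)"
    using n by (simp_all add: t_def field_simps)
  then show "t \<noteq> 1" using n by auto
  then have "2 * \<i> * of_real (c_of t) = 2 * \<i> * of_real b"
    using unit_circle_identities(3)[OF t] n by (simp add: t1)
  then show "c_of t = b" by simp
qed

text \<open>A self-map of the half-plane which preserves the kernel \<open>1 / (u + cnj u')\<close> up to a
  rank-one factor is a Moebius map; it is affine if the rotation \<open>l\<close> it induces in the disc
  coordinate is trivial.\<close>

lemma half_plane_kernel_map:
  fixes V C :: "complex \<Rightarrow> complex"
  assumes pos: "\<And>u. Re u > 0 \<Longrightarrow> Re (V u) > 0"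
    and eq: "\<And>u u'. Re u > 0 \<Longrightarrow> Re u' > 0 \<Longrightarrow> V u + cnj (V u') = C u * cnj (C u') * (u + cnj u')"
  obtains (affine) a b k where "a > 0" "k \<noteq> 0"
      "\<And>u. Re u > 0 \<Longrightarrow> V u = of_real a * u + \<i> * of_real b"
      "\<And>u. Re u > 0 \<Longrightarrow> C u = k"
  | (inversion) a b c k where "a > 0" "k \<noteq> 0"
      "\<And>u. Re u > 0 \<Longrightarrow> V u = \<i> * of_real b + of_real a / (u - \<i> * of_real c)"
      "\<And>u. Re u > 0 \<Longrightarrow> C u = k / (u - \<i> * of_real c)"
proof -
  \<comment> \<open>The centre \<open>u = 1/2\<close> of the disc coordinate serves as base
    point.\<close>
  define v0 where "v0 = V (1/2)"
  define c0 where "c0 = C (1/2)"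
  define m where "m = 2 * Re v0"
  have m: "m > 0" using pos[of "1/2"] by (simp add: m_def v0_def)
  have vv: "v0 + cnj v0 = of_real m" by (simp add: m_def complex_eq_iff)
  have cc: "c0 * cnj c0 = of_real m" using eq[of "1/2" "1/2"] vv by (simp add: v0_def c0_def)
  have c0: "c0 \<noteq> 0" using cc m by auto
  have e1: "V u + cnj v0 = C u * cnj c0 * (u + 1/2)" if "Re u > 0" for u
    using eq[OF that, of "1/2"] by (simp add: v0_def c0_def)
  \<comment> \<open>Combining the general identity with its instances at the base point eliminates
    the kernel and leaves a function of \<open>u\<close> times a function of
    \<open>u'\<close>.\<close>
  have e2: "(V u - v0) * cnj (V u' - v0) = of_real m * (C u * cnj (C u')) * ((u - 1/2) * cnj (u' - 1/2))"
    if u: "Re u > 0" "Re u' > 0" for u u'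
  proof -
    have "(V u - v0) * cnj (V u' - v0) = (V u + cnj v0) * cnj (V u' + cnj v0) - (v0 + cnj v0) * (V u + cnj (V u'))"
      by (simp add: algebra_simps)
    also have "\<dots> = (c0 * cnj c0) * (C u * cnj (C u')) * ((u + 1/2) * cnj (u' + 1/2))
        - of_real m * (C u * cnj (C u') * (u + cnj u'))"
      unfolding e1[OF u(1)] e1[OF u(2)] vv eq[OF u] by (simp add: mult_ac)
    also have "\<dots> = of_real m * (C u * cnj (C u')) * ((u + 1/2) * cnj (u' + 1/2) - (u + cnj u'))"
      unfolding cc by (simp add: algebra_simps)
    also have "(u + 1/2) * cnj (u' + 1/2) - (u + cnj u') = (u - 1/2) * cnj (u' - 1/2)"
      by (simp add: algebra_simps)
    finally show ?thesis .
  qed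
  \<comment> \<open>A second point, different from the base point, fixes the phase of
    \<open>V u - v0\<close>.\<close>
  define d where "d = V (3/2) - v0"
  define c1 where "c1 = C (3/2)"
  have dd: "d * cnj d = of_real m * (c1 * cnj c1)"
    using e2[of "3/2" "3/2"] by (simp add: d_def c1_def)
  have c1: "c1 \<noteq> 0"
  proof
    assume "c1 = 0"
    then have "V (3/2) + cnj (V (3/2)) = 0" using eq[of "3/2" "3/2"] by (simp add: c1_def)
    then show False using pos[of "3/2"] by (simp add: complex_eq_iff)
  qed
  have d: "d \<noteq> 0" using dd c1 m by auto
  \<comment> \<open>By \<open>e1\<close> and \<open>e3\<close>,
    \<open>(V u - v0) / (V u + cnj v0)\<close> is \<open>l\<close> times the disc coordinate of
    \<open>u\<close>; hence \<open>l\<close> is the rotation induced in the disc.\<close>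
  define l where "l = of_real m * cnj c1 / (cnj d * cnj c0)"
  have "l * cnj l = (of_real m * of_real m * (c1 * cnj c1)) / ((d * cnj d) * (c0 * cnj c0))"
    by (simp add: l_def mult_ac)
  also have "\<dots> = 1" unfolding dd cc using c1 m by simp
  finally have "l * cnj l = 1" .
  then have "complex_of_real ((cmod l)\<^sup>2) = 1" by (simp only: complex_norm_square)
  then have "(cmod l)\<^sup>2 = 1" by (simp only: of_real_eq_1_iff)
  then have l: "cmod l = 1" by (simp add: abs_square_eq_1)
  have e3: "V u - v0 = l * cnj c0 * C u * (u - 1/2)" if u: "Re u > 0" for u
  proof -
    have "(V u - v0) * cnj d = of_real m * (C u * cnj c1) * (u - 1/2)"
      using e2[OF u, of "3/2"] by (simp add: d_def c1_def)
    then have "V u - v0 = of_real m * (C u * cnj c1) * (u - 1/2) / cnj d"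
      using d by (simp add: field_simps)
    then show ?thesis using c0 by (simp add: l_def mult_ac)
  qed
  \<comment> \<open>Subtracting \<open>e3\<close> from \<open>e1\<close> eliminates
    \<open>V u\<close> and leaves a linear equation for \<open>C u\<close>.\<close>
  have e4: "C u * ((u + 1/2) - l * (u - 1/2)) = c0" if u: "Re u > 0" for u
  proof -
    have "cnj c0 * c0 = (V u + cnj v0) - (V u - v0)"
      unfolding mult.commute[of "cnj c0"] cc vv[symmetric] by simp
    also have "\<dots> = cnj c0 * (C u * ((u + 1/2) - l * (u - 1/2)))"
      unfolding e1[OF u] e3[OF u] by (simp add: algebra_simps)
    finally show ?thesis using c0 by simp
  qed
  have e5: "V u = C u * cnj c0 * (u + 1/2) - cnj v0" if u: "Re u > 0" for u
    using e1[OF u] by (simp add: algebra_simps)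
  show thesis
  proof (cases "l = 1")
    case True
    have C: "C u = c0" if "Re u > 0" for u using e4[OF that] True by simp
    have "V u = of_real m * u + \<i> * of_real (Im v0)" if "Re u > 0" for u
      unfolding e5[OF that] C[OF that] cc by (simp add: complex_eq_iff m_def algebra_simps)
    then show thesis using affine m c0 C by blast
  next
    case False
    note id = unit_circle_identities[OF l False]
    have n: "1 - l \<noteq> 0" "l - 1 \<noteq> 0" using False by auto
    let ?w = "\<lambda>u. u - \<i> * of_real (c_of l)"
    have ic: "\<i> * of_real (c_of l) = (l + 1) / (2 * (l - 1))"
      using id(3) n by (simp add: field_simps)
    \<comment> \<open>The pole of the map lies at \<open>i * c_of l\<close>, on the imaginary axis
      because \<open>l\<close> has modulus one.\<close>
    have D: "(u + 1/2) - l * (u - 1/2) = (1 - l) * ?w u" for u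
      unfolding ic using n by (simp add: field_simps)
    have w: "?w u \<noteq> 0" if "Re u > 0" for u using that by (auto simp: complex_eq_iff)
    have C: "C u = (c0 / (1 - l)) / ?w u" if u: "Re u > 0" for u
      using e4[OF u] w[OF u] n unfolding D divide_divide_eq_left by (intro eq_divide_imp) auto
    \<comment> \<open>The constant term of \<open>V\<close> is purely imaginary because
      \<open>1 / (1 - l)\<close> has real part \<open>1/2\<close>.\<close>
    define b where "b = Im (of_real m / (1 - l) - cnj v0)"
    have ib: "of_real m / (1 - l) - cnj v0 = \<i> * of_real b"
    proof -
      have "Re (of_real m * (1 / (1 - l)) - cnj v0) = m * Re (1 / (1 - l)) - Re v0"
        by (simp only: minus_complex.sel times_complex.sel Re_complex_of_real Im_complex_of_real complex_cnj) simp
      also have "\<dots> = 0" unfolding id(1) by (simp add: m_def)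
      finally show ?thesis by (simp add: b_def complex_eq_iff)
    qed
    \<comment> \<open>The residue of \<open>V\<close> at its pole; the second unit circle identity
      shows that it is positive.\<close>
    define a where "a = m / (cmod (1 - l))\<^sup>2"
    have a: "a > 0" using m n by (simp add: a_def)
    have al: "of_real a = of_real m * (- l / (1 - l)\<^sup>2)" unfolding id(2) by (simp add: a_def)
    have V: "V u = \<i> * of_real b + of_real a / ?w u" if u: "Re u > 0" for u
    proof -
      have h: "u + 1/2 = ?w u + l / (l - 1)"
      proof -
        have "l / (l - 1) = (l + 1) / (2 * (l - 1)) + 1/2"
          using n by (simp add: divide_simps)
        then show ?thesis unfolding ic by simp
      qed
      have "C u * cnj c0 * (u + 1/2) = (c0 * cnj c0) / (1 - l) * ((u + 1/2) / ?w u)"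
        unfolding C[OF u] by simp
      also have "(u + 1/2) / ?w u = 1 + (l / (l - 1)) / ?w u"
        using w[OF u] by (subst h) (simp only: add_divide_distrib divide_self simp_thms not_False_eq_True)
      finally have "C u * cnj c0 * (u + 1/2) = of_real m / (1 - l) + of_real m / (1 - l) * (l / (l - 1)) / ?w u"
        unfolding cc by (simp only: distrib_left mult_1_right times_divide_eq_right)
      also have "of_real m / (1 - l) * (l / (l - 1)) = of_real a"
        unfolding al using n by (simp add: divide_simps power2_eq_square) (simp add: algebra_simps)
      finally show ?thesis unfolding e5[OF u] ib[symmetric] by simp
    qed
    have "c0 / (1 - l) \<noteq> 0" using c0 n by simp
    then show thesis using inversion[OF a _ V C] by blast
  qed
qed

section \<open>Operators as maps of the half-plane\<close>

text \<open>\<open>V\<close> and \<open>C\<close> record the exponent and the coefficient of the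
  image of each monomial. Inner products of two monomials give the kernel identity, and pairing
  \<open>T f\<close> with the image of a monomial gives the transform rule.\<close>

lemma monomial_unitary_mellin:
  assumes U: "unitary_op T" and Mo: "monomial_op T"
  obtains V C where "\<And>u. Re u > 0 \<Longrightarrow> Re (V u) > 0"
    "\<And>u u'. Re u > 0 \<Longrightarrow> Re u' > 0 \<Longrightarrow> V u + cnj (V u') = C u * cnj (C u') * (u + cnj u')"
    "\<And>f g u. f \<in> L2 \<Longrightarrow> g \<in> L2 \<Longrightarrow> ae_eq (T f) g \<Longrightarrow> Re u > 0 \<Longrightarrow>
      mellin f u = cnj (C u) * mellin g (V u)"
proof -
  have T: "T f \<in> L2" if "f \<in> L2" for f
    using U that by (simp add: unitary_op_def bounded_op_def)
  have Ti: "l2_inner (T f) (T g) = l2_inner f g" if "f \<in> L2" "g \<in> L2" for f g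
    using U that by (simp add: unitary_op_def)
  have "\<forall>s\<in>Shalf. \<exists>p. fst p \<in> Shalf \<and> ae_eq (T (mon s)) (\<lambda>x. snd p * mon (fst p) x)"
    using Mo unfolding monomial_op_def by fastforce
  then obtain P where P: "\<And>s. s \<in> Shalf \<Longrightarrow> fst (P s) \<in> Shalf"
    "\<And>s. s \<in> Shalf \<Longrightarrow> ae_eq (T (mon s)) (\<lambda>x. snd (P s) * mon (fst (P s)) x)"
    by metis
  define V where "V = (\<lambda>u. fst (P (u - 1/2)) + 1/2)"
  define C where "C = (\<lambda>u. snd (P (u - 1/2)))"
  have S: "u - 1/2 \<in> Shalf \<and> mon (u - 1/2) \<in> L2" if "Re u > 0" for u
    using that by (auto simp: Shalf_def intro: mon_L2)
  have Vpos: "Re (V u) > 0" if "Re u > 0" for u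
    using P(1)[of "u - 1/2"] S[OF that] by (simp add: V_def Shalf_def)
  have TV: "ae_eq (T (mon (u - 1/2))) (\<lambda>x. C u * mon (V u - 1/2) x)" if "Re u > 0" for u
    using P(2)[of "u - 1/2"] S[OF that] by (simp add: V_def C_def)
  show thesis
  proof
    show "Re (V u) > 0" if "Re u > 0" for u by (rule Vpos[OF that])
    show "V u + cnj (V u') = C u * cnj (C u') * (u + cnj u')" if u: "Re u > 0" "Re u' > 0" for u u'
    proof -
      have "l2_inner (T (mon (u - 1/2))) (T (mon (u' - 1/2)))
          = l2_inner (\<lambda>x. C u * mon (V u - 1/2) x) (\<lambda>x. C u' * mon (V u' - 1/2) x)"
        using u S Vpos by (intro inner_cong T TV L2_scale) auto
      then have "l2_inner (mon (u - 1/2)) (mon (u' - 1/2))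
          = C u * cnj (C u') * l2_inner (mon (V u - 1/2)) (mon (V u' - 1/2))"
        using Ti S u by (simp add: inner_scale_left inner_scale_right)
      moreover have "l2_inner (mon (a - 1/2)) (mon (a' - 1/2)) = 1 / (a + cnj a')"
        if "Re a > 0" "Re a' > 0" for a a'
        using that inner_mon_mon[of "a - 1/2" "a' - 1/2"] by simp
      moreover have "a + cnj a' \<noteq> 0" if "Re a > 0" "Re a' > 0" for a a'
        using that by (auto simp: complex_eq_iff)
      ultimately have "1 / (u + cnj u') = C u * cnj (C u') * (1 / (V u + cnj (V u')))"
        "u + cnj u' \<noteq> 0" "V u + cnj (V u') \<noteq> 0"
        using u Vpos by auto
      then show ?thesis by (simp add: field_simps)
    qed
    show "mellin f u = cnj (C u) * mellin g (V u)"
      if f: "f \<in> L2" and g: "g \<in> L2" and fg: "ae_eq (T f) g" and u: "Re u > 0" for f g u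
    proof -
      have "mellin f u = l2_inner (T f) (T (mon (u - 1/2)))"
        using Ti f S u by (simp add: mellin_def)
      also have "\<dots> = l2_inner g (\<lambda>x. C u * mon (V u - 1/2) x)"
        using u S Vpos f g fg by (intro inner_cong T TV L2_scale) auto
      finally show ?thesis by (simp add: inner_scale_right mellin_def)
    qed
  qed
qed

text \<open>The maps \<open>u \<mapsto> (u - ib) / a\<close> for the parameters
  \<open>(a, b)\<close> and \<open>(1/a, -b/a)\<close> are mutually inverse, and the scalar factors
  cancel.\<close>

lemma mellin_dilate_inverse:
  assumes a: "a > 0" and f: "f \<in> L2" and k: "k \<noteq> 0" and u: "Re u > 0"
  shows "mellin (\<lambda>x. k * dilate a b (\<lambda>x. (1 / k) * dilate (1 / a) (- b / a) f x) x) u = mellin f u"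
proof -
  let ?g = "\<lambda>x. (1 / k) * dilate (1 / a) (- b / a) f x"
  let ?v = "(u - \<i> * of_real b) / of_real a"
  have v: "Re ?v > 0" using u a by (simp add: Re_divide_of_real)
  have g: "?g \<in> L2" using a f by (intro L2_scale dilate_L2) auto
  have "mellin (\<lambda>x. k * dilate a b ?g x) u = k * (of_real (1 / sqrt a) * mellin ?g ?v)"
    unfolding mellin_scale mellin_dilate[OF a g u] ..
  also have "mellin ?g ?v = (1 / k) * (of_real (1 / sqrt (1 / a))
      * mellin f ((?v - \<i> * of_real (- b / a)) / of_real (1 / a)))"
    unfolding mellin_scale using a by (subst mellin_dilate[OF _ f v]) auto
  also have "(?v - \<i> * of_real (- b / a)) / of_real (1 / a) = u"
    using a by (simp add: field_simps)
  finally show ?thesis using a k by (simp add: real_sqrt_divide flip: of_real_mult)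
qed

text \<open>Comparison of transforms shows that \<open>T\<close> is a scalar multiple of
  \<open>dilate a b\<close> up to null sets. \<open>dilate_L2_on\<close> gives one inclusion, the
  inverse dilation the other.\<close>

lemma affine_op_image:
  assumes U: "unitary_op T" and a: "a > 0" and k: "k \<noteq> 0" and r: "r > 0"
    and T: "\<And>f g u. f \<in> L2 \<Longrightarrow> g \<in> L2 \<Longrightarrow> ae_eq (T f) g \<Longrightarrow> Re u > 0 \<Longrightarrow>
      mellin f u = cnj k * mellin g (of_real a * u + \<i> * of_real b)"
  shows "op_image T (L2_on r) = L2_on (r powr (1 / a))"
proof -
  have TL: "T f \<in> L2" if "f \<in> L2" for f
    using U that by (simp add: unitary_op_def bounded_op_def)
  define q where "q = of_real (sqrt a) / cnj k"
  have q: "q \<noteq> 0" using a k by (simp add: q_def)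
  have S: "ae_eq g (\<lambda>x. q * dilate a b f x)" if f: "f \<in> L2" and g: "g \<in> L2" and fg: "ae_eq (T f) g" for f g
  proof (rule mellin_inject)
    show "(\<lambda>x. q * dilate a b f x) \<in> L2" by (intro L2_scale dilate_L2 a f)
    fix w :: complex assume w: "Re w > 0"
    let ?u = "(w - \<i> * of_real b) / of_real a"
    have u: "Re ?u > 0" using w a by (simp add: Re_divide_of_real)
    have "of_real a * ?u + \<i> * of_real b = w" using a by simp
    then have "mellin f ?u = cnj k * mellin g w" using T[OF f g fg u] by simp
    then show "mellin g w = mellin (\<lambda>x. q * dilate a b f x) w"
      unfolding mellin_scale mellin_dilate[OF a f w] using a k by (simp add: q_def)
  qed fact
  show ?thesis
  proof safe
    fix g assume "g \<in> op_image T (L2_on r)"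
    then obtain f where g: "g \<in> L2" and f: "f \<in> L2_on r" and fg: "ae_eq (T f) g"
      by (auto simp: op_image_def)
    have "ae_eq (\<lambda>x. q * dilate a b f x) g"
      using S[OF L2_on_L2[OF f] g fg] by (auto simp: ae_eq_def)
    then show "g \<in> L2_on (r powr (1 / a))"
      by (rule L2_on_cong[OF L2_on_scale[OF dilate_L2_on[OF a r f]] g])
  next
    fix g assume g: "g \<in> L2_on (r powr (1 / a))"
    note gL = L2_on_L2[OF g]
    define f where "f = (\<lambda>x. (1 / q) * dilate (1 / a) (- b / a) g x)"
    have "f \<in> L2_on ((r powr (1 / a)) powr (1 / (1 / a)))"
      unfolding f_def using a r g by (intro L2_on_scale dilate_L2_on) auto
    then have f: "f \<in> L2_on r" using a r by (simp add: powr_powr)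
    note fL = L2_on_L2[OF f]
    have "ae_eq (T f) (\<lambda>x. q * dilate a b f x)"
      by (rule S[OF fL TL[OF fL]]) (simp add: ae_eq_def)
    moreover have "ae_eq (\<lambda>x. q * dilate a b f x) g"
    proof (rule mellin_inject[OF _ gL])
      show "(\<lambda>x. q * dilate a b f x) \<in> L2" by (intro L2_scale dilate_L2 a fL)
      show "mellin (\<lambda>x. q * dilate a b f x) u = mellin g u" if "Re u > 0" for u
        unfolding f_def by (rule mellin_dilate_inverse[OF a gL q that])
    qed
    ultimately have "ae_eq (T f) g" unfolding ae_eq_def by eventually_elim simp
    then show "g \<in> op_image T (L2_on r)" using f gL by (auto simp: op_image_def)
  qed
qed

text \<open>Up to null sets \<open>T\<close> is a scaled dilation followed by \<open>J\<close> and
  multiplication by \<open>x^(ib)\<close>. Undoing the dilation before \<open>T\<close> shows that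
  the twist is defined on all of \<open>L2\<close>.\<close>

lemma inversion_op_image:
  assumes U: "unitary_op T" and a: "a > 0" and k: "k \<noteq> 0" and r: "r > 0"
    and T: "\<And>f g u. f \<in> L2 \<Longrightarrow> g \<in> L2 \<Longrightarrow> ae_eq (T f) g \<Longrightarrow> Re u > 0 \<Longrightarrow>
      mellin f u = cnj (k / (u - \<i> * of_real c)) * mellin g (\<i> * of_real b + of_real a / (u - \<i> * of_real c))"
  shows "op_image T (L2_on r) = mult_image b (J_image (L2_on (r powr (4 * a))))"
    and "\<And>f. f \<in> L2 \<Longrightarrow> \<exists>g\<in>L2. J_twist b f g"
proof -
  have TL: "T f \<in> L2" if "f \<in> L2" for f
    using U that by (simp add: unitary_op_def bounded_op_def)
  \<comment> \<open>With \<open>z = w - ib\<close>, these parameters make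
    \<open>(1 / (4z) - ib') / a'\<close> equal to \<open>ic + a / z\<close>; the scalar
    \<open>q\<close> matches the prefactors.\<close>
  define a' where "a' = 1 / (4 * a)"
  define b' where "b' = - c / (4 * a)"
  define q where "q = cnj (2 * of_real a / k) * of_real (sqrt a')"
  have a': "a' > 0" using a by (simp add: a'_def)
  have q: "q \<noteq> 0" using a k a' by (simp add: q_def)
  have S: "J_twist b (\<lambda>x. q * dilate a' b' f x) g" if f: "f \<in> L2" and g: "g \<in> L2" and fg: "ae_eq (T f) g" for f g
    unfolding J_twist_def
  proof (intro allI impI)
    fix w :: complex assume w: "Re w > 0"
    let ?z = "w - \<i> * of_real b"
    let ?u = "\<i> * of_real c + of_real a / ?z"
    have z: "Re ?z > 0" "?z \<noteq> 0" using w by (auto simp: complex_eq_iff)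
    have u: "Re ?u > 0"
      using z a by (simp add: Re_divide add_pos_nonneg)
    have z4: "Re (1 / (4 * ?z)) > 0"
      using z by (simp add: Re_divide add_pos_nonneg)
    have e: "?u - \<i> * of_real c = of_real a / ?z" by simp
    have "\<i> * of_real b + of_real a / (?u - \<i> * of_real c) = w"
      unfolding e using z a by simp
    then have fu: "mellin f ?u = cnj (k / (of_real a / ?z)) * mellin g w"
      using T[OF f g fg u] unfolding e by simp
    have arg: "(1 / (4 * ?z) - \<i> * of_real b') / of_real a' = ?u"
      using z a by (simp add: a'_def b'_def field_simps)
    have "cnj (1 / (2 * ?z)) * mellin (\<lambda>x. q * dilate a' b' f x) (1 / (4 * ?z))
        = cnj (1 / (2 * ?z)) * (q * (of_real (1 / sqrt a') * mellin f ?u))"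
      unfolding mellin_scale mellin_dilate[OF a' f z4] arg ..
    also have "\<dots> = (of_real (sqrt a') * of_real (1 / sqrt a'))
        * cnj ((1 / (2 * ?z)) * (2 * of_real a / k) * (k / (of_real a / ?z))) * mellin g w"
      unfolding q_def fu by (simp only: complex_cnj_mult mult_ac)
    also have "(1 / (2 * ?z)) * (2 * of_real a / k) * (k / (of_real a / ?z)) = 1"
      using z a k by simp
    also have "complex_of_real (sqrt a') * of_real (1 / sqrt a') = 1"
      using a' by simp
    finally show "mellin g w = cnj (1 / (2 * ?z)) * mellin (\<lambda>x. q * dilate a' b' f x) (1 / (4 * ?z))"
      by simp
  qed
  \<comment> \<open>\<open>R\<close> inverts the scaled dilation, so \<open>T (R F)\<close> realises
    the twist of \<open>F\<close>.\<close>
  define R where "R = (\<lambda>F x. (1 / q) * dilate (1 / a') (- b' / a') F x)"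
  have R: "R F \<in> L2" if "F \<in> L2" for F
    unfolding R_def using a' that by (intro L2_scale dilate_L2) auto
  have J: "J_twist b F (T (R F))" if F: "F \<in> L2" for F
  proof -
    have J: "J_twist b (\<lambda>x. q * dilate a' b' (R F) x) (T (R F))"
      by (rule S[OF R[OF F] TL[OF R[OF F]]]) (simp add: ae_eq_def)
    show ?thesis unfolding J_twist_def
    proof (intro allI impI)
      fix u :: complex assume u: "Re u > 0"
      then have "Re (1 / (4 * (u - \<i> * of_real b))) > 0"
        by (simp add: Re_divide add_pos_nonneg)
      note inv = mellin_dilate_inverse[OF a' F q this, of b']
      show "mellin (T (R F)) u = cnj (1 / (2 * (u - \<i> * of_real b))) * mellin F (1 / (4 * (u - \<i> * of_real b)))"
        using J[unfolded J_twist_def, rule_format, OF u] inv unfolding R_def by simp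
    qed
  qed
  show "\<exists>g\<in>L2. J_twist b f g" if "f \<in> L2" for f using J[OF that] TL[OF R[OF that]] by blast
  have r': "r powr (1 / a') = r powr (4 * a)" using a by (simp add: a'_def)
  show "op_image T (L2_on r) = mult_image b (J_image (L2_on (r powr (4 * a))))"
  proof safe
    fix g assume "g \<in> op_image T (L2_on r)"
    then obtain f where g: "g \<in> L2" and f: "f \<in> L2_on r" and fg: "ae_eq (T f) g"
      by (auto simp: op_image_def)
    have "(\<lambda>x. q * dilate a' b' f x) \<in> L2_on (r powr (4 * a))"
      unfolding r'[symmetric] by (intro L2_on_scale dilate_L2_on a' r f)
    with S[OF L2_on_L2[OF f] g fg] g show "g \<in> mult_image b (J_image (L2_on (r powr (4 * a))))"
      using mem_mult_J_image_iff[OF L2_on_subset] by blast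
  next
    fix g assume "g \<in> mult_image b (J_image (L2_on (r powr (4 * a))))"
    then obtain F where g: "g \<in> L2" and F: "F \<in> L2_on (r powr (4 * a))" and JF: "J_twist b F g"
      using mem_mult_J_image_iff[OF L2_on_subset] by blast
    note FL = L2_on_L2[OF F]
    have "R F \<in> L2_on ((r powr (4 * a)) powr (1 / (1 / a')))"
      unfolding R_def using a' r F by (intro L2_on_scale dilate_L2_on) auto
    then have RF: "R F \<in> L2_on r" using a r by (simp add: powr_powr a'_def)
    have "ae_eq (T (R F)) g"
    proof (rule mellin_inject[OF TL[OF R[OF FL]] g])
      show "mellin (T (R F)) u = mellin g u" if "Re u > 0" for u
        using J[OF FL] JF that unfolding J_twist_def by simp
    qed
    with RF g show "g \<in> op_image T (L2_on r)" by (auto simp: op_image_def)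
  qed
qed

section \<open>Parameters of an atomic space\<close>

theorem theorem1p22:
  fixes M :: "(real \<Rightarrow> complex) set"
  assumes "atomic M"
  shows "\<exists>!p. fst p \<in> sphere (0::complex) 1 \<and> snd p > (0::real) \<and> M = A_space (fst p) (snd p)"
proof -
  obtain r T where r: "0 < r" "r < 1" and U: "unitary_op T" and Mo: "monomial_op T"
    and M: "M = op_image T (L2_on r)"
    using assms by (auto simp: atomic_def)
  obtain V C where V: "\<And>u. Re u > 0 \<Longrightarrow> Re (V u) > 0"
    and VC: "\<And>u u'. Re u > 0 \<Longrightarrow> Re u' > 0 \<Longrightarrow> V u + cnj (V u') = C u * cnj (C u') * (u + cnj u')"
    and T: "\<And>f g u. f \<in> L2 \<Longrightarrow> g \<in> L2 \<Longrightarrow> ae_eq (T f) g \<Longrightarrow> Re u > 0 \<Longrightarrow>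
      mellin f u = cnj (C u) * mellin g (V u)"
    using monomial_unitary_mellin[OF U Mo] by metis
  have A1: "A_space 1 w = L2_on (exp (- 2 * w))" for w
    by (simp add: A_space_def A_one_def)
  have A2: "A_space t w = mult_image (c_of t) (J_image (L2_on (exp (- 2 * ((1 + 4 * (c_of t)\<^sup>2) * w)))))"
    if "t \<noteq> 1" for t w
    using that by (simp add: A_space_def A_minus_one_def A_one_def)
  have c4: "1 + 4 * c\<^sup>2 > 0" for c :: real by (simp add: add_pos_nonneg)
  show ?thesis
  proof (rule half_plane_kernel_map[OF V VC])
    fix a b k
    assume affine: "a > 0" "k \<noteq> 0"
      "\<And>u. Re u > 0 \<Longrightarrow> V u = of_real a * u + \<i> * of_real b"
      "\<And>u. Re u > 0 \<Longrightarrow> C u = k"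
    define s where "s = r powr (1 / a)"
    have s: "0 < s" "s < 1" using r affine(1) powr_less_mono2[of "1 / a" r 1] by (auto simp: s_def)
    have Ms: "M = L2_on s" unfolding M s_def
      by (rule affine_op_image[OF U affine(1,2) r(1)]) (use T affine(3,4) in auto)
    show ?thesis
    proof (rule ex1I)
      \<comment> \<open>The value \<open>- ln s / 2\<close> solves
        \<open>exp (- 2 * w) = s\<close>.\<close>
      show "fst (1, - ln s / 2) \<in> sphere (0::complex) 1 \<and> snd (1, - ln s / 2) > (0::real)
          \<and> M = A_space (fst (1, - ln s / 2)) (snd (1, - ln s / 2))"
        using s by (simp add: A1 Ms)
      fix p :: "complex \<times> real"
      assume p: "fst p \<in> sphere 0 1 \<and> snd p > 0 \<and> M = A_space (fst p) (snd p)"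
      have "fst p = 1"
      proof (rule ccontr)
        assume "fst p \<noteq> 1"
        then have "L2_on s = mult_image (c_of (fst p))
            (J_image (L2_on (exp (- 2 * ((1 + 4 * (c_of (fst p))\<^sup>2) * snd p)))))"
          using p A2[of "fst p" "snd p"] Ms by simp
        then show False using L2_on_neq_mult_J_image[OF s exp_gt_zero] by blast
      qed
      moreover from this have "exp (- 2 * snd p) = s"
        using p s unfolding Ms by (intro L2_on_inject) (auto simp: A1)
      then have "ln s = - 2 * snd p" by (metis ln_exp)
      ultimately show "p = (1, - ln s / 2)" by (simp add: prod_eq_iff)
    qed
  next
    fix a b c k
    assume inversion: "a > 0" "k \<noteq> 0"
      "\<And>u. Re u > 0 \<Longrightarrow> V u = \<i> * of_real b + of_real a / (u - \<i> * of_real c)"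
      "\<And>u. Re u > 0 \<Longrightarrow> C u = k / (u - \<i> * of_real c)"
    define s where "s = r powr (4 * a)"
    have s: "0 < s" "s < 1" using r inversion(1) powr_less_mono2[of "4 * a" r 1] by (auto simp: s_def)
    have T': "mellin f u = cnj (k / (u - \<i> * of_real c)) * mellin g (\<i> * of_real b + of_real a / (u - \<i> * of_real c))"
      if "f \<in> L2" "g \<in> L2" "ae_eq (T f) g" "Re u > 0" for f g u
      using T[OF that] inversion(3,4)[OF that(4)] by simp
    have Ms: "M = mult_image b (J_image (L2_on s))" unfolding M s_def
      by (rule inversion_op_image(1)[OF U inversion(1,2) r(1) T'])
    have total: "\<exists>g\<in>L2. J_twist b f g" if "f \<in> L2" for f
      by (rule inversion_op_image(2)[OF U inversion(1,2) r(1) T' that])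
    obtain t where t: "cmod t = 1" "t \<noteq> 1" "c_of t = b" by (rule c_of_surj)
    \<comment> \<open>\<open>A_space\<close> multiplies its second parameter by this factor, so
      \<open>w\<close> is divided by it.\<close>
    define D where "D = 1 + 4 * b\<^sup>2"
    define w where "w = - ln s / 2 / D"
    have D: "D > 0" using c4[of b] by (simp add: D_def)
    have w0: "w > 0" unfolding w_def using s D by (intro divide_pos_pos) auto
    have "D * w = - ln s / 2" using D by (simp add: w_def)
    then have w: "w > 0" "exp (- 2 * ((1 + 4 * b\<^sup>2) * w)) = s"
      using s w0 by (simp_all add: D_def)
    show ?thesis
    proof (rule ex1I)
      show "fst (t, w) \<in> sphere (0::complex) 1 \<and> snd (t, w) > (0::real) \<and> M = A_space (fst (t, w)) (snd (t, w))"
        using t w by (simp add: A2 Ms)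
      fix p :: "complex \<times> real"
      assume p: "fst p \<in> sphere 0 1 \<and> snd p > 0 \<and> M = A_space (fst p) (snd p)"
      let ?c = "c_of (fst p)" and ?s = "exp (- 2 * ((1 + 4 * (c_of (fst p))\<^sup>2) * snd p))"
      have p1: "fst p \<noteq> 1"
      proof
        assume "fst p = 1"
        then have "L2_on (exp (- 2 * snd p)) = mult_image b (J_image (L2_on s))"
          using p A1 Ms by simp
        moreover have "0 < exp (- 2 * snd p)" "exp (- 2 * snd p) < 1" using p by auto
        ultimately show False using L2_on_neq_mult_J_image s by blast
      qed
      have eq: "mult_image b (J_image (L2_on s)) = mult_image ?c (J_image (L2_on ?s))"
        using p A2[OF p1] Ms by simp
      have s': "0 < ?s" "?s < 1" using p c4[of ?c] by auto
      have cs: "b = ?c" "s = ?s" using mult_J_image_inject[OF total eq s s'] by auto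
      have "fst p = t" using c_of_inject[of "fst p" t] p p1 t cs by simp
      moreover have "snd p = w"
      proof -
        have "(1 + 4 * b\<^sup>2) * w = (1 + 4 * b\<^sup>2) * snd p" using cs w(2) by simp
        then show ?thesis using c4[of b] by simp
      qed
      ultimately show "p = (t, w)" by (simp add: prod_eq_iff)
    qed
  qed
qed

end
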